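(* Each of the following set theories interprets Peano arithmetic $\mathsf{PA}$: (1) $\mathsf{ReS}_0+\mathsf{Foundation}$; (2) $\mathsf{ReS}_0+\mathsf{Repl}$.
   Context: Interpretability: for first-order theories $S,T$, "$T$ interprets $S$" means that a fixed finite family of parameter-free formulas in the language of $T$ defines, in every model of $T$, a nonempty quotient structure satisfying $S$; the formulas specify the domain, an equivalence relation on that domain (serving as equality), and the interpretations of the relations and functions of $S$. Set theories are in the first-order language $\{\in\}$. $\Delta_0$ formulas contain only quantifiers $\forall x\in a$, $\exists x\in a$. $\mathsf{ReS}_0$ consists of Extensionality, Empty Set, Pairing, Set Difference ($x\setminus y$ exists), Union, and Separation for $\Delta_0$ formulas. $\mathsf{Foundation}$ is the full Foundation scheme: for every formula $A$ of $\{\in\}$, $\exists x\,A(x,\bar p)\to\exists x\,(A(x,\bar p)\wedge\forall y\in x\,\neg A(y,\bar p))$. $\mathsf{Repl}$ is the full Replacement scheme: for every formula $\varphi$ of $\{\in\}$, $\forall x\in a\,\exists! y\,\varphi(x,y,\bar p)\to\exists b\,\forall y\,(y\in b\leftrightarrow\exists x\in a\,\varphi(x,y,\bar p))$. *)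

theory Defs
  imports Main "HOL-Library.Countable_Set"
begin

section \<open>First-order logic with equality\<close>

text \<open>Formulas use de Bruijn indices: under a quantifier, \<open>Var 0\<close> is the bound variable and
  \<open>Var (Suc i)\<close> is the variable that is called \<open>Var i\<close> outside.\<close>

datatype 'f tm = Var nat | Fn 'f "'f tm list"

datatype ('f, 'r) fm =
    Eq "'f tm" "'f tm"
  | Rel 'r "'f tm list"
  | Neg "('f, 'r) fm"
  | And "('f, 'r) fm" "('f, 'r) fm"
  | Or "('f, 'r) fm" "('f, 'r) fm"
  | Imp "('f, 'r) fm" "('f, 'r) fm"
  | All "('f, 'r) fm"
  | Ex "('f, 'r) fm"

abbreviation Iff :: "('f, 'r) fm \<Rightarrow> ('f, 'r) fm \<Rightarrow> ('f, 'r) fm" where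
  "Iff \<phi> \<psi> \<equiv> And (Imp \<phi> \<psi>) (Imp \<psi> \<phi>)"

text \<open>A language assigns arities to its symbols; \<open>None\<close> means that the value of type \<open>'f\<close>
  (or \<open>'r\<close>) is not a symbol of the language.\<close>

record ('f, 'r) lang =
  funs :: "'f \<Rightarrow> nat option"
  rels :: "'r \<Rightarrow> nat option"

fun wf_tm :: "('f, 'r) lang \<Rightarrow> 'f tm \<Rightarrow> bool" where
  "wf_tm L (Var i) = True"
| "wf_tm L (Fn f ts) = (funs L f = Some (length ts) \<and> (\<forall>t\<in>set ts. wf_tm L t))"

fun wf_fm :: "('f, 'r) lang \<Rightarrow> ('f, 'r) fm \<Rightarrow> bool" where
  "wf_fm L (Eq s t) = (wf_tm L s \<and> wf_tm L t)"
| "wf_fm L (Rel r ts) = (rels L r = Some (length ts) \<and> (\<forall>t\<in>set ts. wf_tm L t))"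
| "wf_fm L (Neg \<phi>) = wf_fm L \<phi>"
| "wf_fm L (And \<phi> \<psi>) = (wf_fm L \<phi> \<and> wf_fm L \<psi>)"
| "wf_fm L (Or \<phi> \<psi>) = (wf_fm L \<phi> \<and> wf_fm L \<psi>)"
| "wf_fm L (Imp \<phi> \<psi>) = (wf_fm L \<phi> \<and> wf_fm L \<psi>)"
| "wf_fm L (All \<phi>) = wf_fm L \<phi>"
| "wf_fm L (Ex \<phi>) = wf_fm L \<phi>"

fun fv_tm :: "'f tm \<Rightarrow> nat set" where
  "fv_tm (Var i) = {i}"
| "fv_tm (Fn f ts) = (\<Union>t\<in>set ts. fv_tm t)"

fun fv :: "('f, 'r) fm \<Rightarrow> nat set" where
  "fv (Eq s t) = fv_tm s \<union> fv_tm t"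
| "fv (Rel r ts) = (\<Union>t\<in>set ts. fv_tm t)"
| "fv (Neg \<phi>) = fv \<phi>"
| "fv (And \<phi> \<psi>) = fv \<phi> \<union> fv \<psi>"
| "fv (Or \<phi> \<psi>) = fv \<phi> \<union> fv \<psi>"
| "fv (Imp \<phi> \<psi>) = fv \<phi> \<union> fv \<psi>"
| "fv (All \<phi>) = {i. Suc i \<in> fv \<phi>}"
| "fv (Ex \<phi>) = {i. Suc i \<in> fv \<phi>}"

fun subst_tm :: "(nat \<Rightarrow> 'f tm) \<Rightarrow> 'f tm \<Rightarrow> 'f tm" where
  "subst_tm \<sigma> (Var i) = \<sigma> i"
| "subst_tm \<sigma> (Fn f ts) = Fn f (map (subst_tm \<sigma>) ts)"

definition lift_subst :: "(nat \<Rightarrow> 'f tm) \<Rightarrow> nat \<Rightarrow> 'f tm" where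
  "lift_subst \<sigma> = case_nat (Var 0) (\<lambda>i. subst_tm (\<lambda>j. Var (Suc j)) (\<sigma> i))"

fun subst :: "(nat \<Rightarrow> 'f tm) \<Rightarrow> ('f, 'r) fm \<Rightarrow> ('f, 'r) fm" where
  "subst \<sigma> (Eq s t) = Eq (subst_tm \<sigma> s) (subst_tm \<sigma> t)"
| "subst \<sigma> (Rel r ts) = Rel r (map (subst_tm \<sigma>) ts)"
| "subst \<sigma> (Neg \<phi>) = Neg (subst \<sigma> \<phi>)"
| "subst \<sigma> (And \<phi> \<psi>) = And (subst \<sigma> \<phi>) (subst \<sigma> \<psi>)"
| "subst \<sigma> (Or \<phi> \<psi>) = Or (subst \<sigma> \<phi>) (subst \<sigma> \<psi>)"
| "subst \<sigma> (Imp \<phi> \<psi>) = Imp (subst \<sigma> \<phi>) (subst \<sigma> \<psi>)"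
| "subst \<sigma> (All \<phi>) = All (subst (lift_subst \<sigma>) \<phi>)"
| "subst \<sigma> (Ex \<phi>) = Ex (subst (lift_subst \<sigma>) \<phi>)"

abbreviation ren :: "(nat \<Rightarrow> nat) \<Rightarrow> ('f, 'r) fm \<Rightarrow> ('f, 'r) fm" where
  "ren \<rho> \<equiv> subst (\<lambda>i. Var (\<rho> i))"

record ('f, 'r, 'm) struct =
  carrier :: "'m set"
  fn :: "'f \<Rightarrow> 'm list \<Rightarrow> 'm"
  rl :: "'r \<Rightarrow> 'm list \<Rightarrow> bool"

definition is_struct :: "('f, 'r) lang \<Rightarrow> ('f, 'r, 'm) struct \<Rightarrow> bool" where
  "is_struct L M \<longleftrightarrow> carrier M \<noteq> {} \<and>
     (\<forall>f xs. funs L f = Some (length xs) \<and> set xs \<subseteq> carrier M \<longrightarrow> fn M f xs \<in> carrier M)"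

fun tval :: "('f, 'r, 'm) struct \<Rightarrow> (nat \<Rightarrow> 'm) \<Rightarrow> 'f tm \<Rightarrow> 'm" where
  "tval M e (Var i) = e i"
| "tval M e (Fn f ts) = fn M f (map (tval M e) ts)"

fun sat :: "('f, 'r, 'm) struct \<Rightarrow> (nat \<Rightarrow> 'm) \<Rightarrow> ('f, 'r) fm \<Rightarrow> bool" where
  "sat M e (Eq s t) = (tval M e s = tval M e t)"
| "sat M e (Rel r ts) = rl M r (map (tval M e) ts)"
| "sat M e (Neg \<phi>) = (\<not> sat M e \<phi>)"
| "sat M e (And \<phi> \<psi>) = (sat M e \<phi> \<and> sat M e \<psi>)"
| "sat M e (Or \<phi> \<psi>) = (sat M e \<phi> \<or> sat M e \<psi>)"
| "sat M e (Imp \<phi> \<psi>) = (sat M e \<phi> \<longrightarrow> sat M e \<psi>)"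
| "sat M e (All \<phi>) = (\<forall>x\<in>carrier M. sat M (case_nat x e) \<phi>)"
| "sat M e (Ex \<phi>) = (\<exists>x\<in>carrier M. sat M (case_nat x e) \<phi>)"

text \<open>A theory is a set of formulas. Free variables in an axiom are parameters and are
  understood as universally quantified.\<close>

definition models :: "('f, 'r) lang \<Rightarrow> ('f, 'r, 'm) struct \<Rightarrow> ('f, 'r) fm set \<Rightarrow> bool" where
  "models L M T \<longleftrightarrow> is_struct L M \<and>
     (\<forall>\<phi>\<in>T. \<forall>e. range e \<subseteq> carrier M \<longrightarrow> sat M e \<phi>)"


section \<open>Interpretations\<close>

text \<open>An interpretation of the language \<open>('f, 'r)\<close> in the language \<open>('g, 's)\<close>: formulas for the
  domain, for the equivalence relation, for the graph of each function symbol (arguments first,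
  value last) and for each relation symbol.\<close>

record ('f, 'r, 'g, 's) interp =
  dom_fm :: "('g, 's) fm"
  eq_fm :: "('g, 's) fm"
  fn_fm :: "'f \<Rightarrow> ('g, 's) fm"
  rl_fm :: "'r \<Rightarrow> ('g, 's) fm"

definition fm_of_arity :: "('g, 's) lang \<Rightarrow> nat \<Rightarrow> ('g, 's) fm \<Rightarrow> bool" where
  "fm_of_arity K n \<phi> \<longleftrightarrow> wf_fm K \<phi> \<and> fv \<phi> \<subseteq> {..<n}"

definition wf_interp ::
  "('f, 'r) lang \<Rightarrow> ('g, 's) lang \<Rightarrow> ('f, 'r, 'g, 's) interp \<Rightarrow> bool" where
  "wf_interp L K I \<longleftrightarrow>
     fm_of_arity K 1 (dom_fm I) \<and> fm_of_arity K 2 (eq_fm I) \<and>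
     (\<forall>f n. funs L f = Some n \<longrightarrow> fm_of_arity K (Suc n) (fn_fm I f)) \<and>
     (\<forall>r n. rels L r = Some n \<longrightarrow> fm_of_arity K n (rl_fm I r))"

text \<open>Only used for \<open>fv \<phi> \<subseteq> {..<length xs}\<close>, so that the unspecified values of
  \<open>(!) xs\<close> beyond the end of the list do not matter.\<close>

definition holds :: "('g, 's, 'm) struct \<Rightarrow> ('g, 's) fm \<Rightarrow> 'm list \<Rightarrow> bool" where
  "holds M \<phi> xs \<longleftrightarrow> sat M ((!) xs) \<phi>"

definition int_dom :: "('f, 'r, 'g, 's) interp \<Rightarrow> ('g, 's, 'm) struct \<Rightarrow> 'm set" where
  "int_dom I M = {x \<in> carrier M. holds M (dom_fm I) [x]}"

definition int_eq :: "('f, 'r, 'g, 's) interp \<Rightarrow> ('g, 's, 'm) struct \<Rightarrow> ('m \<times> 'm) set" where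
  "int_eq I M = {(x, y). x \<in> int_dom I M \<and> y \<in> int_dom I M \<and> holds M (eq_fm I) [x, y]}"

definition respects_eq :: "('m \<times> 'm) set \<Rightarrow> nat \<Rightarrow> ('m list \<Rightarrow> bool) \<Rightarrow> bool" where
  "respects_eq E n P \<longleftrightarrow>
     (\<forall>xs ys. length xs = n \<and> list_all2 (\<lambda>x y. (x, y) \<in> E) xs ys \<longrightarrow> (P xs \<longleftrightarrow> P ys))"

text \<open>The formulas of \<open>I\<close> define in \<open>M\<close> a nonempty quotient structure for \<open>L\<close>.\<close>

definition defines_struct ::
  "('f, 'r) lang \<Rightarrow> ('f, 'r, 'g, 's) interp \<Rightarrow> ('g, 's, 'm) struct \<Rightarrow> bool" where
  "defines_struct L I M \<longleftrightarrow>
     int_dom I M \<noteq> {} \<and>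
     equiv (int_dom I M) (int_eq I M) \<and>
     (\<forall>r n. rels L r = Some n \<longrightarrow> respects_eq (int_eq I M) n (holds M (rl_fm I r))) \<and>
     (\<forall>f n. funs L f = Some n \<longrightarrow>
        respects_eq (int_eq I M) (Suc n) (holds M (fn_fm I f)) \<and>
        (\<forall>xs. length xs = n \<and> set xs \<subseteq> int_dom I M \<longrightarrow>
           (\<exists>y\<in>int_dom I M. holds M (fn_fm I f) (xs @ [y]) \<and>
              (\<forall>z\<in>int_dom I M. holds M (fn_fm I f) (xs @ [z]) \<longrightarrow> (y, z) \<in> int_eq I M))))"

definition quot_struct ::
  "('f, 'r, 'g, 's) interp \<Rightarrow> ('g, 's, 'm) struct \<Rightarrow> ('f, 'r, 'm set) struct" where
  "quot_struct I M =
    \<lparr>carrier = int_dom I M // int_eq I M,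
     fn = (\<lambda>f Xs. THE Y. Y \<in> int_dom I M // int_eq I M \<and>
             (\<exists>xs y. list_all2 (\<in>) xs Xs \<and> y \<in> Y \<and> holds M (fn_fm I f) (xs @ [y]))),
     rl = (\<lambda>r Xs. \<exists>xs. list_all2 (\<in>) xs Xs \<and> holds M (rl_fm I r) xs)\<rparr>"

text \<open>\<open>'m\<close> is the type in which the carriers of the models of \<open>T\<close> live; a carrier is an arbitrary
  nonempty subset of \<open>'m\<close>.\<close>

definition is_interpretation ::
  "'m itself \<Rightarrow> ('g, 's) lang \<Rightarrow> ('g, 's) fm set \<Rightarrow> ('f, 'r) lang \<Rightarrow> ('f, 'r) fm set \<Rightarrow>
     ('f, 'r, 'g, 's) interp \<Rightarrow> bool" where
  "is_interpretation (_ :: 'm itself) K T L S I \<longleftrightarrow>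
     wf_interp L K I \<and>
     (\<forall>M :: ('g, 's, 'm) struct. models K M T \<longrightarrow>
        defines_struct L I M \<and> models L (quot_struct I M) S)"

text \<open>HOL has no quantification over types inside a formula, so the type of the elements of the
  models is a parameter here. The theorem \<open>is_interpretation_any_type\<close> at the end of this
  theory shows that this does not make the choice of the formulas depend on the type: formulas
  that work for \<^typ>\<open>nat\<close> work for every type.\<close>

definition interprets ::
  "'m itself \<Rightarrow> ('g, 's) lang \<Rightarrow> ('g, 's) fm set \<Rightarrow> ('f, 'r) lang \<Rightarrow> ('f, 'r) fm set \<Rightarrow> bool" where
  "interprets (_ :: 'm itself) K T L S \<longleftrightarrow> (\<exists>I. is_interpretation TYPE('m) K T L S I)"


section \<open>Set theories\<close>

datatype set_rel = Elem

definition L_set :: "(unit, set_rel) lang" where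
  "L_set = \<lparr>funs = (\<lambda>_. None), rels = (\<lambda>_. Some 2)\<rparr>"

type_synonym set_fm = "(unit, set_rel) fm"

abbreviation Mem :: "nat \<Rightarrow> nat \<Rightarrow> set_fm" where
  "Mem i j \<equiv> Rel Elem [Var i, Var j]"

abbreviation EqV :: "nat \<Rightarrow> nat \<Rightarrow> set_fm" where
  "EqV i j \<equiv> Eq (Var i) (Var j)"

text \<open>In the bounded quantifiers the bound is \<open>Var i\<close> outside the quantifier, hence
  \<open>Var (Suc i)\<close> inside and distinct from the bound variable.\<close>

inductive Delta0 :: "set_fm \<Rightarrow> bool" where
  "Delta0 (EqV i j)"
| "Delta0 (Mem i j)"
| "Delta0 \<phi> \<Longrightarrow> Delta0 (Neg \<phi>)"
| "Delta0 \<phi> \<Longrightarrow> Delta0 \<psi> \<Longrightarrow> Delta0 (And \<phi> \<psi>)"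
| "Delta0 \<phi> \<Longrightarrow> Delta0 \<psi> \<Longrightarrow> Delta0 (Or \<phi> \<psi>)"
| "Delta0 \<phi> \<Longrightarrow> Delta0 \<psi> \<Longrightarrow> Delta0 (Imp \<phi> \<psi>)"
| "Delta0 \<phi> \<Longrightarrow> Delta0 (All (Imp (Mem 0 (Suc i)) \<phi>))"
| "Delta0 \<phi> \<Longrightarrow> Delta0 (Ex (And (Mem 0 (Suc i)) \<phi>))"

definition extensionality_ax :: set_fm where
  "extensionality_ax = All (All (Imp (All (Iff (Mem 0 1) (Mem 0 2))) (EqV 0 1)))"

definition empty_set_ax :: set_fm where
  "empty_set_ax = Ex (All (Neg (Mem 0 1)))"

definition pairing_ax :: set_fm where
  "pairing_ax = All (All (Ex (All (Iff (Mem 0 1) (Or (EqV 0 3) (EqV 0 2))))))"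

definition set_difference_ax :: set_fm where
  "set_difference_ax = All (All (Ex (All (Iff (Mem 0 1) (And (Mem 0 3) (Neg (Mem 0 2)))))))"

definition union_ax :: set_fm where
  "union_ax = All (Ex (All (Iff (Mem 0 1) (Ex (And (Mem 0 3) (Mem 1 0))))))"

text \<open>Inserts one new variable directly outside the innermost one.\<close>

abbreviation skip1 :: "('f, 'r) fm \<Rightarrow> ('f, 'r) fm" where
  "skip1 \<equiv> ren (case_nat 0 (\<lambda>i. i + 2))"

text \<open>In \<open>\<phi>\<close>, \<open>Var 0\<close> is \<open>x\<close> and the other variables are parameters; the set \<open>a\<close> that is
  separated from is \<open>Var 0\<close> of the axiom, i.e. \<open>Var 1\<close> in \<open>\<phi>\<close>. The new set \<open>b\<close> does not
  occur in \<open>\<phi>\<close>: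
  \<open>\<exists>b. \<forall>x. x \<in> b \<longleftrightarrow> x \<in> a \<and> \<phi>(x, a, p)\<close>.\<close>

definition separation_ax :: "set_fm \<Rightarrow> set_fm" where
  "separation_ax \<phi> = Ex (All (Iff (Mem 0 1) (And (Mem 0 2) (skip1 \<phi>))))"

definition foundation_ax :: "set_fm \<Rightarrow> set_fm" where
  "foundation_ax \<phi> =
     Imp (Ex \<phi>) (Ex (And \<phi> (All (Imp (Mem 0 1) (Neg (skip1 \<phi>))))))"

text \<open>\<open>\<exists>!y. \<phi>(y)\<close>, as \<open>\<exists>y. \<forall>z. \<phi>(z) \<longleftrightarrow> z = y\<close>.\<close>

abbreviation ExU :: "set_fm \<Rightarrow> set_fm" where
  "ExU \<phi> \<equiv> Ex (All (Iff (skip1 \<phi>) (EqV 0 1)))"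

text \<open>In \<open>\<phi>\<close>, \<open>Var 0\<close> is \<open>y\<close>, \<open>Var 1\<close> is \<open>x\<close> and the other variables are parameters; the set
  \<open>a\<close> is \<open>Var 0\<close> of the axiom, i.e. \<open>Var 2\<close> in \<open>\<phi>\<close>. The renaming in the conclusion accounts for
  the variables being bound there in the order \<open>b\<close>, \<open>y\<close>, \<open>x\<close>.\<close>

definition replacement_ax :: "set_fm \<Rightarrow> set_fm" where
  "replacement_ax \<phi> =
     Imp (All (Imp (Mem 0 1) (ExU \<phi>)))
         (Ex (All (Iff (Mem 0 1)
            (Ex (And (Mem 0 3) (ren (case_nat 1 (case_nat 0 (\<lambda>i. i + 3))) \<phi>))))))"

definition ReS0 :: "set_fm set" where
  "ReS0 = {extensionality_ax, empty_set_ax, pairing_ax, set_difference_ax, union_ax}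
          \<union> {separation_ax \<phi> | \<phi>. Delta0 \<phi>}"

definition Foundation :: "set_fm set" where
  "Foundation = {foundation_ax \<phi> | \<phi>. wf_fm L_set \<phi>}"

definition Repl :: "set_fm set" where
  "Repl = {replacement_ax \<phi> | \<phi>. wf_fm L_set \<phi>}"


section \<open>Peano arithmetic\<close>

datatype pa_fun = Zero | Succ | Plus | Times

definition L_PA :: "(pa_fun, unit) lang" where
  "L_PA = \<lparr>funs = (\<lambda>f. case f of Zero \<Rightarrow> Some 0 | Succ \<Rightarrow> Some 1 | Plus \<Rightarrow> Some 2 | Times \<Rightarrow> Some 2),
           rels = (\<lambda>_. None)\<rparr>"

type_synonym pa_fm = "(pa_fun, unit) fm"

abbreviation ZeroT :: "pa_fun tm" where "ZeroT \<equiv> Fn Zero []"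
abbreviation SuccT :: "pa_fun tm \<Rightarrow> pa_fun tm" where "SuccT t \<equiv> Fn Succ [t]"
abbreviation PlusT :: "pa_fun tm \<Rightarrow> pa_fun tm \<Rightarrow> pa_fun tm" where "PlusT s t \<equiv> Fn Plus [s, t]"
abbreviation TimesT :: "pa_fun tm \<Rightarrow> pa_fun tm \<Rightarrow> pa_fun tm" where "TimesT s t \<equiv> Fn Times [s, t]"

definition induction_ax :: "pa_fm \<Rightarrow> pa_fm" where
  "induction_ax \<phi> =
     Imp (And (subst (case_nat ZeroT Var) \<phi>)
              (All (Imp \<phi> (subst (case_nat (SuccT (Var 0)) (\<lambda>i. Var (Suc i))) \<phi>))))
         (All \<phi>)"

definition PA :: "pa_fm set" where
  "PA =
    {All (Neg (Eq (SuccT (Var 0)) ZeroT)),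
     All (All (Imp (Eq (SuccT (Var 0)) (SuccT (Var 1))) (Eq (Var 0) (Var 1)))),
     All (Eq (PlusT (Var 0) ZeroT) (Var 0)),
     All (All (Eq (PlusT (Var 0) (SuccT (Var 1))) (SuccT (PlusT (Var 0) (Var 1))))),
     All (Eq (TimesT (Var 0) ZeroT) ZeroT),
     All (All (Eq (TimesT (Var 0) (SuccT (Var 1))) (PlusT (TimesT (Var 0) (Var 1)) (Var 0))))}
    \<union> {induction_ax \<phi> | \<phi>. wf_fm L_PA \<phi>}"


section \<open>Independence of interpretability from the type of the models\<close>

instance tm :: (countable) countable by countable_datatype
instance fm :: (countable, countable) countable by countable_datatype

lemma tval_cong: "(\<And>i. i \<in> fv_tm t \<Longrightarrow> e i = e' i) \<Longrightarrow> tval M e t = tval M e' t"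
proof (induction t)
  case (Fn f ts)
  then have "map (tval M e) ts = map (tval M e') ts" by (auto intro!: map_cong)
  then show ?case by (simp only: tval.simps)
qed simp

lemma sat_cong: "(\<And>i. i \<in> fv \<phi> \<Longrightarrow> e i = e' i) \<Longrightarrow> sat M e \<phi> = sat M e' \<phi>"
proof (induction \<phi> arbitrary: e e')
  case (Eq s t)
  then show ?case using tval_cong[of s e e' M] tval_cong[of t e e' M] by simp
next
  case (Rel r ts)
  then have "map (tval M e) ts = map (tval M e') ts" by (auto intro!: map_cong tval_cong)
  then show ?case by (simp only: sat.simps)
next
  case (All \<phi>)
  have "sat M (case_nat x e) \<phi> = sat M (case_nat x e') \<phi>" for x
    by (rule All.IH) (use All.prems in \<open>auto split: nat.split\<close>)
  then show ?case by simp
next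
  case (Ex \<phi>)
  have "sat M (case_nat x e) \<phi> = sat M (case_nat x e') \<phi>" for x
    by (rule Ex.IH) (use Ex.prems in \<open>auto split: nat.split\<close>)
  then show ?case by simp
next
  case (Neg \<phi>)
  from Neg.IH[of e e'] Neg.prems show ?case by simp
next
  case (And \<phi> \<psi>)
  from And.IH[of e e'] And.prems show ?case by simp
next
  case (Or \<phi> \<psi>)
  from Or.IH[of e e'] Or.prems show ?case by simp
next
  case (Imp \<phi> \<psi>)
  from Imp.IH[of e e'] Imp.prems show ?case by simp
qed

lemma finite_fv_tm: "finite (fv_tm t)"
  by (induction t) auto

lemma finite_fv: "finite (fv \<phi>)"
proof (induction \<phi>)
  case (All \<phi>)
  have "{i. Suc i \<in> fv \<phi>} = Suc -` fv \<phi>" by auto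
  then show ?case using All by (simp add: finite_vimageI)
next
  case (Ex \<phi>)
  have "{i. Suc i \<in> fv \<phi>} = Suc -` fv \<phi>" by auto
  then show ?case using Ex by (simp add: finite_vimageI)
qed (auto simp: finite_fv_tm)

lemma tval_in: "\<lbrakk>is_struct L M; wf_tm L t; range e \<subseteq> carrier M\<rbrakk> \<Longrightarrow> tval M e t \<in> carrier M"
  by (induction t) (auto simp: is_struct_def image_subset_iff)

text \<open>The Tarski--Vaught test for an embedding \<open>h\<close> of \<open>N\<close> into \<open>M\<close>.\<close>

lemma tarski_vaught:
  assumes N: "is_struct L N"
    and h: "inj_on h (carrier N)" "h ` carrier N \<subseteq> carrier M"
    and hfn: "\<And>f xs. funs L f = Some (length xs) \<Longrightarrow> set xs \<subseteq> carrier N \<Longrightarrow>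
               h (fn N f xs) = fn M f (map h xs)"
    and hrl: "\<And>r xs. rels L r = Some (length xs) \<Longrightarrow> set xs \<subseteq> carrier N \<Longrightarrow>
               rl N r xs = rl M r (map h xs)"
    and tv: "\<And>\<phi> e y. range e \<subseteq> carrier N \<Longrightarrow> y \<in> carrier M \<Longrightarrow>
               sat M (case_nat y (h \<circ> e)) \<phi> \<Longrightarrow>
               \<exists>x\<in>carrier N. sat M (case_nat (h x) (h \<circ> e)) \<phi>"
  shows "wf_fm L \<phi> \<Longrightarrow> range e \<subseteq> carrier N \<Longrightarrow> sat N e \<phi> = sat M (h \<circ> e) \<phi>"
proof (induction \<phi> arbitrary: e)
  have tv': "wf_tm L t \<Longrightarrow> range e \<subseteq> carrier N \<Longrightarrow> h (tval N e t) = tval M (h \<circ> e) t" for t e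
  proof (induction t)
    case (Fn f ts)
    have "h (fn N f (map (tval N e) ts)) = fn M f (map h (map (tval N e) ts))"
      by (rule hfn) (use Fn.prems tval_in[OF N] in auto)
    also have "map h (map (tval N e) ts) = map (tval M (h \<circ> e)) ts"
      using Fn by (auto simp: o_def)
    finally show ?case by (simp only: tval.simps)
  qed simp
  {
    case (Eq s t)
    then have "tval N e s \<in> carrier N" "tval N e t \<in> carrier N" using tval_in[OF N] by auto
    then have "(tval N e s = tval N e t) = (h (tval N e s) = h (tval N e t))"
      using h(1) by (auto dest: inj_onD)
    moreover have "h (tval N e s) = tval M (h \<circ> e) s" "h (tval N e t) = tval M (h \<circ> e) t"
      using Eq tv' by auto
    ultimately show ?case by (simp only: sat.simps)
  next
    case (Rel r ts)
    have "rl N r (map (tval N e) ts) = rl M r (map h (map (tval N e) ts))"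
      by (rule hrl) (use Rel tval_in[OF N] in auto)
    also have "map h (map (tval N e) ts) = map (tval M (h \<circ> e)) ts"
      using Rel tv' by auto
    finally show ?case by (simp only: sat.simps)
  next
    case (All \<phi>)
    have *: "h \<circ> case_nat x e = case_nat (h x) (h \<circ> e)" for x
      by (auto simp: fun_eq_iff split: nat.split)
    have IH: "sat N (case_nat x e) \<phi> = sat M (case_nat (h x) (h \<circ> e)) \<phi>" if "x \<in> carrier N" for x
      unfolding *[symmetric]
      by (rule All.IH) (use All.prems that in \<open>auto simp: image_subset_iff split: nat.split\<close>)
    show ?case
      using IH h(2) tv[OF All.prems(2), of _ "Neg \<phi>"] by (auto simp: image_subset_iff o_def)
  next
    case (Ex \<phi>)
    have *: "h \<circ> case_nat x e = case_nat (h x) (h \<circ> e)" for x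
      by (auto simp: fun_eq_iff split: nat.split)
    have IH: "sat N (case_nat x e) \<phi> = sat M (case_nat (h x) (h \<circ> e)) \<phi>" if "x \<in> carrier N" for x
      unfolding *[symmetric]
      by (rule Ex.IH) (use Ex.prems that in \<open>auto simp: image_subset_iff split: nat.split\<close>)
    show ?case
      using IH h(2) tv[OF Ex.prems(2), of _ "\<phi>"] by (auto simp: image_subset_iff o_def)
  }
qed auto

datatype 'i hull_tm = Base nat | Op 'i "'i hull_tm list"

instance hull_tm :: (countable) countable by countable_datatype

fun hull_val :: "(nat \<Rightarrow> 'm) \<Rightarrow> ('i \<Rightarrow> 'm list \<Rightarrow> 'm) \<Rightarrow> 'i hull_tm \<Rightarrow> 'm" where
  "hull_val b op (Base n) = b n"
| "hull_val b op (Op i ts) = op i (map (hull_val b op) ts)"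

lemma countable_hull:
  fixes op :: "'i::countable \<Rightarrow> 'm list \<Rightarrow> 'm"
  assumes A: "countable A" "A \<subseteq> C" "A \<noteq> {}"
    and op: "\<And>i xs. set xs \<subseteq> C \<Longrightarrow> op i xs \<in> C"
  obtains B where "countable B" "A \<subseteq> B" "B \<subseteq> C"
    "\<And>i xs. set xs \<subseteq> B \<Longrightarrow> op i xs \<in> B"
proof
  let ?B = "range (hull_val (from_nat_into A) op)"
  show "countable ?B" by simp
  show "A \<subseteq> ?B"
  proof
    fix x assume "x \<in> A"
    then have "x = hull_val (from_nat_into A) op (Base (to_nat_on A x))" using A by simp
    then show "x \<in> ?B" by blast
  qed
  have "hull_val (from_nat_into A) op t \<in> C" for t
  proof (induction t)
    case (Base n)
    then show ?case using from_nat_into[OF A(3), of n] A(2) by auto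
  next
    case (Op i ts)
    then show ?case by (auto intro!: op)
  qed
  then show "?B \<subseteq> C" by blast
  fix i xs assume "set xs \<subseteq> ?B"
  then have "xs \<in> lists ?B" by auto
  then obtain ts where "xs = map (hull_val (from_nat_into A) op) ts"
    unfolding lists_image by auto
  then have "op i xs = hull_val (from_nat_into A) op (Op i ts)" by simp
  then show "op i xs \<in> ?B" by blast
qed

definition choose_witness :: "'m \<Rightarrow> 'm set \<Rightarrow> ('m \<Rightarrow> bool) \<Rightarrow> 'm" where
  "choose_witness a C P = (if \<exists>x\<in>C. P x then SOME x. x \<in> C \<and> P x else a)"

lemma choose_witness_in: "a \<in> C \<Longrightarrow> choose_witness a C P \<in> C"
  unfolding choose_witness_def by (metis (mono_tags, lifting) someI_ex)

lemma choose_witness: "y \<in> C \<Longrightarrow> P y \<Longrightarrow> P (choose_witness a C P)"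
  unfolding choose_witness_def by (metis (mono_tags, lifting) someI_ex)

text \<open>Finitely many values of an assignment, as a list.\<close>

lemma sat_case_nat_list:
  assumes "\<And>i. Suc i \<in> fv \<phi> \<Longrightarrow> i < n"
  shows "sat M (case_nat y (\<lambda>i. map e [0..<n] ! i)) \<phi> = sat M (case_nat y e) \<phi>"
  by (rule sat_cong) (use assms in \<open>auto split: nat.split\<close>)

lemma fv_bound: obtains n where "\<And>i. i \<in> fv \<phi> \<Longrightarrow> i < n"
  using finite_nat_set_iff_bounded[of "fv \<phi>"] finite_fv by metis

text \<open>The downward Loewenheim--Skolem theorem, with the submodel transported to \<^typ>\<open>nat\<close>.\<close>

lemma loewenheim_skolem:
  fixes M :: "('g::countable, 's::countable, 'm) struct"
    and op :: "'i::countable \<Rightarrow> 'm list \<Rightarrow> 'm"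
  assumes M: "is_struct K M"
    and A: "countable A" "A \<subseteq> carrier M"
    and op: "\<And>i xs. set xs \<subseteq> carrier M \<Longrightarrow> op i xs \<in> carrier M"
  obtains N :: "('g, 's, nat) struct" and g where
    "is_struct K N" "g ` carrier N \<subseteq> carrier M" "inj_on g (carrier N)" "A \<subseteq> g ` carrier N"
    "\<And>i xs. set xs \<subseteq> g ` carrier N \<Longrightarrow> op i xs \<in> g ` carrier N"
    "\<And>\<phi> e. wf_fm K \<phi> \<Longrightarrow> range e \<subseteq> carrier N \<Longrightarrow> sat N e \<phi> = sat M (g \<circ> e) \<phi>"
proof -
  obtain a where a: "a \<in> carrier M" using M by (auto simp: is_struct_def)
  define op' :: "'i + 'g + ('g, 's) fm \<Rightarrow> 'm list \<Rightarrow> 'm" where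
    "op' j xs = (case j of Inl i \<Rightarrow> op i xs
       | Inr (Inl f) \<Rightarrow> (if funs K f = Some (length xs) then fn M f xs else a)
       | Inr (Inr \<phi>) \<Rightarrow> choose_witness a (carrier M) (\<lambda>y. sat M (case_nat y ((!) xs)) \<phi>))" for j xs
  obtain B where B: "countable B" "insert a A \<subseteq> B" "B \<subseteq> carrier M"
    "\<And>j xs. set xs \<subseteq> B \<Longrightarrow> op' j xs \<in> B"
  proof (rule countable_hull[of "insert a A" "carrier M" op'])
    fix j xs assume "set xs \<subseteq> carrier M"
    then show "op' j xs \<in> carrier M"
      using M a op choose_witness_in[OF a]
      by (auto simp: op'_def is_struct_def split: sum.split)
  qed (use A a in auto)
  define g where "g = from_nat_into B"
  define d where "d = to_nat_on B"
  have gd: "g (d x) = x" if "x \<in> B" for x using that B(1) by (simp add: g_def d_def)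
  define N :: "('g, 's, nat) struct" where
    "N = \<lparr>carrier = d ` B, fn = (\<lambda>f xs. d (fn M f (map g xs))), rl = (\<lambda>r xs. rl M r (map g xs))\<rparr>"
  have gC: "g ` carrier N = B" using gd by (force simp: N_def)
  have fnB: "fn M f xs \<in> B" if "funs K f = Some (length xs)" "set xs \<subseteq> B" for f xs
    using B(4)[OF that(2), of "Inr (Inl f)"] that by (simp add: op'_def)
  have gmem: "set (map g xs) \<subseteq> B" if "set xs \<subseteq> carrier N" for xs using that gC by auto
  have N: "is_struct K N"
    unfolding is_struct_def
  proof (intro conjI allI impI)
    show "carrier N \<noteq> {}" using B(2) by (auto simp: N_def)
    fix f xs assume "funs K f = Some (length xs) \<and> set xs \<subseteq> carrier N"
    then have "fn M f (map g xs) \<in> B" using fnB[of f "map g xs"] gmem by auto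
    then show "fn N f xs \<in> carrier N" by (simp add: N_def)
  qed
  have inj: "inj_on g (carrier N)" using gd by (auto simp: N_def inj_on_def)
  show thesis
  proof (rule that[OF N])
    show "g ` carrier N \<subseteq> carrier M" "A \<subseteq> g ` carrier N" using gC B by auto
    show "inj_on g (carrier N)" by (rule inj)
    show "op i xs \<in> g ` carrier N" if "set xs \<subseteq> g ` carrier N" for i xs
      using B(4)[of xs "Inl i"] that gC by (simp add: op'_def)
    show "sat N e \<phi> = sat M (g \<circ> e) \<phi>" if wf: "wf_fm K \<phi>" "range e \<subseteq> carrier N" for \<phi> e
    proof (rule tarski_vaught[OF N inj _ _ _ _ wf])
      show "g ` carrier N \<subseteq> carrier M" using gC B by auto
      show "g (fn N f xs) = fn M f (map g xs)"
        if "funs K f = Some (length xs)" "set xs \<subseteq> carrier N" for f xs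
        using that fnB[of f "map g xs"] gmem[of xs] by (auto simp: N_def gd)
      show "rl N r xs = rl M r (map g xs)" for r xs by (simp add: N_def)
      fix \<phi> :: "('g, 's) fm" and e y
      assume *: "range e \<subseteq> carrier N" "y \<in> carrier M" "sat M (case_nat y (g \<circ> e)) \<phi>"
      obtain n where n: "\<And>i. i \<in> fv \<phi> \<Longrightarrow> i < n" using fv_bound by blast
      have n': "i < n" if "Suc i \<in> fv \<phi>" for i using n[OF that] by simp
      let ?xs = "map (g \<circ> e) [0..<n]"
      have eq: "sat M (case_nat z ((!) ?xs)) \<phi> = sat M (case_nat z (g \<circ> e)) \<phi>" for z
        using sat_case_nat_list[of \<phi> n M z "g \<circ> e"] n' by blast
      let ?w = "op' (Inr (Inr \<phi>)) ?xs"
      have "set ?xs \<subseteq> B" using *(1) gC by auto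
      then have "?w \<in> B" by (rule B(4))
      moreover have "sat M (case_nat ?w ((!) ?xs)) \<phi>"
        unfolding op'_def using choose_witness[of y "carrier M"] *(2,3) eq by simp
      ultimately show "\<exists>x\<in>carrier N. sat M (case_nat (g x) (g \<circ> e)) \<phi>"
        using eq gC by (metis imageE)
    qed
  qed
qed

lemma respects_eqD:
  "\<lbrakk>respects_eq E n P; length xs = n; list_all2 (\<lambda>x y. (x, y) \<in> E) xs ys\<rbrakk> \<Longrightarrow> P xs = P ys"
  unfolding respects_eq_def by blast

text \<open>In a defined structure, relations and functions can be computed on representatives.\<close>

lemma list_all2_Image:
  assumes E: "equiv D E" and xs: "set xs \<subseteq> D"
  shows "list_all2 (\<in>) ys (map (\<lambda>x. E `` {x}) xs) \<longleftrightarrow> list_all2 (\<lambda>x y. (x, y) \<in> E) xs ys"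
  by (auto simp: list_all2_conv_all_nth)

lemma quot_rl:
  assumes d: "defines_struct L I M" and r: "rels L r = Some (length xs)"
    and xs: "set xs \<subseteq> int_dom I M"
  shows "rl (quot_struct I M) r (map (\<lambda>x. int_eq I M `` {x}) xs) = holds M (rl_fm I r) xs"
proof -
  let ?E = "int_eq I M"
  have E: "equiv (int_dom I M) ?E" and c: "respects_eq ?E (length xs) (holds M (rl_fm I r))"
    using d r by (auto simp: defines_struct_def)
  have "(x, x) \<in> ?E" if "x \<in> int_dom I M" for x using E equiv_class_self[OF E that] by simp
  then have "list_all2 (\<lambda>x y. (x, y) \<in> ?E) xs xs"
    using xs by (simp add: list_all2_conv_all_nth subset_iff)
  then have "(\<exists>ys. list_all2 (\<lambda>x y. (x, y) \<in> ?E) xs ys \<and> holds M (rl_fm I r) ys) = holds M (rl_fm I r) xs"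
    using respects_eqD[OF c refl] by blast
  then show ?thesis by (simp add: quot_struct_def list_all2_Image[OF E xs])
qed

lemma quot_fn:
  assumes d: "defines_struct L I M" and f: "funs L f = Some (length xs)"
    and xs: "set xs \<subseteq> int_dom I M" and y: "y \<in> int_dom I M" "holds M (fn_fm I f) (xs @ [y])"
  shows "fn (quot_struct I M) f (map (\<lambda>x. int_eq I M `` {x}) xs) = int_eq I M `` {y}"
proof -
  let ?E = "int_eq I M" and ?D = "int_dom I M"
  have E: "equiv ?D ?E"
    and c: "respects_eq ?E (Suc (length xs)) (holds M (fn_fm I f))"
    and u: "\<exists>y\<in>?D. holds M (fn_fm I f) (xs @ [y]) \<and>
              (\<forall>z\<in>?D. holds M (fn_fm I f) (xs @ [z]) \<longrightarrow> (y, z) \<in> ?E)"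
    using d f xs by (auto simp: defines_struct_def)
  have refl: "(x, x) \<in> ?E" if "x \<in> ?D" for x using equiv_class_self[OF E that] by simp
  have lrefl: "list_all2 (\<lambda>x y. (x, y) \<in> ?E) xs xs"
    using xs by (auto simp: list_all2_conv_all_nth intro!: refl)
  have u': "(y, z) \<in> ?E" if "z \<in> ?D" "holds M (fn_fm I f) (xs @ [z])" for z
    using u y that E by (meson equivE symE transE)
  have "(THE Y. Y \<in> ?D // ?E \<and> (\<exists>ys z. list_all2 (\<lambda>x y. (x, y) \<in> ?E) xs ys \<and> z \<in> Y \<and>
           holds M (fn_fm I f) (ys @ [z]))) = ?E `` {y}"
  proof (rule the_equality)
    show "?E `` {y} \<in> ?D // ?E \<and> (\<exists>ys z. list_all2 (\<lambda>x y. (x, y) \<in> ?E) xs ys \<and> z \<in> ?E `` {y} \<and>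
           holds M (fn_fm I f) (ys @ [z]))"
      using y lrefl refl[OF y(1)] by (auto intro: quotientI)
    fix Y assume "Y \<in> ?D // ?E \<and> (\<exists>ys z. list_all2 (\<lambda>x y. (x, y) \<in> ?E) xs ys \<and> z \<in> Y \<and>
           holds M (fn_fm I f) (ys @ [z]))"
    then obtain ys z where Y: "Y \<in> ?D // ?E" and l: "list_all2 (\<lambda>x y. (x, y) \<in> ?E) xs ys" and
      z: "z \<in> Y" "holds M (fn_fm I f) (ys @ [z])" by blast
    have zD: "z \<in> ?D" using Y z E by (metis in_quotient_imp_subset subsetD)
    have "list_all2 (\<lambda>x y. (x, y) \<in> ?E) (xs @ [z]) (ys @ [z])"
      using l refl[OF zD] by (auto intro: list_all2_appendI)
    then have "holds M (fn_fm I f) (xs @ [z])"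
      using respects_eqD[OF c, of "xs @ [z]" "ys @ [z]"] z by simp
    then have "(y, z) \<in> ?E" using u' zD by blast
    then have "?E `` {y} = ?E `` {z}" by (rule equiv_class_eq[OF E])
    moreover obtain w where "Y = ?E `` {w}" using Y by (rule quotientE)
    moreover from this have "?E `` {w} = ?E `` {z}" using z(1) equiv_class_eq[OF E, of w z] by simp
    ultimately show "Y = ?E `` {y}" by simp
  qed
  then show ?thesis by (simp add: quot_struct_def list_all2_Image[OF E xs])
qed

lemma quot_is_struct:
  assumes d: "defines_struct L I M"
  shows "is_struct L (quot_struct I M)"
  unfolding is_struct_def
proof (intro conjI allI impI)
  let ?E = "int_eq I M" and ?D = "int_dom I M"
  have E: "equiv ?D ?E" "?D \<noteq> {}" using d by (auto simp: defines_struct_def)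
  then show "carrier (quot_struct I M) \<noteq> {}" by (simp add: quot_struct_def)
  fix f Xs
  assume f: "funs L f = Some (length Xs) \<and> set Xs \<subseteq> carrier (quot_struct I M)"
  then have "Xs \<in> lists ((\<lambda>x. ?E `` {x}) ` ?D)"
    by (auto simp: quot_struct_def quotient_def)
  then obtain xs where xs: "Xs = map (\<lambda>x. ?E `` {x}) xs" "set xs \<subseteq> ?D"
    unfolding lists_image by auto
  then obtain y where "y \<in> ?D" "holds M (fn_fm I f) (xs @ [y])"
    using d f unfolding defines_struct_def by auto metis
  then show "fn (quot_struct I M) f Xs \<in> carrier (quot_struct I M)"
    using quot_fn[OF d _ xs(2)] f xs(1) by (auto simp: quot_struct_def quotient_def)
qed

lemma holds_elementary:
  assumes N: "is_struct K N"
    and el: "\<And>\<phi> e. wf_fm K \<phi> \<Longrightarrow> range e \<subseteq> carrier N \<Longrightarrow> sat N e \<phi> = sat M (g \<circ> e) \<phi>"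
    and \<phi>: "fm_of_arity K (length xs) \<phi>" and xs: "set xs \<subseteq> carrier N"
  shows "holds N \<phi> xs = holds M \<phi> (map g xs)"
proof -
  obtain a where a: "a \<in> carrier N" using N by (auto simp: is_struct_def)
  let ?e = "\<lambda>i. if i < length xs then xs ! i else a"
  have "sat N ((!) xs) \<phi> = sat N ?e \<phi>" "sat M ((!) (map g xs)) \<phi> = sat M (g \<circ> ?e) \<phi>"
    using \<phi> by (auto simp: fm_of_arity_def intro!: sat_cong)
  moreover have "range ?e \<subseteq> carrier N" using xs a by auto
  ultimately show ?thesis using el[of \<phi> ?e] \<phi> by (simp add: holds_def fm_of_arity_def)
qed

lemma submodel:
  fixes M :: "('g::countable, 's::countable, 'm) struct"
    and op :: "'i::countable \<Rightarrow> 'm list \<Rightarrow> 'm"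
    and I :: "('f, 'r, 'g, 's) interp"
  assumes M: "models K M T" and T: "\<forall>\<phi>\<in>T. wf_fm K \<phi>" and I: "wf_interp L K I"
    and A: "countable A" "A \<subseteq> carrier M"
    and op: "\<And>i xs. set xs \<subseteq> carrier M \<Longrightarrow> op i xs \<in> carrier M"
  obtains N :: "('g, 's, nat) struct" and g where
    "models K N T" "g ` carrier N \<subseteq> carrier M" "A \<subseteq> g ` carrier N"
    "\<And>i xs. set xs \<subseteq> g ` carrier N \<Longrightarrow> op i xs \<in> g ` carrier N"
    "\<And>\<phi> xs. fm_of_arity K (length xs) \<phi> \<Longrightarrow> set xs \<subseteq> carrier N \<Longrightarrow>
       holds N \<phi> xs = holds M \<phi> (map g xs)"
    "\<And>x. x \<in> carrier N \<Longrightarrow> x \<in> int_dom I N \<longleftrightarrow> g x \<in> int_dom I M"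
    "\<And>x y. x \<in> carrier N \<Longrightarrow> y \<in> carrier N \<Longrightarrow> (x, y) \<in> int_eq I N \<longleftrightarrow> (g x, g y) \<in> int_eq I M"
proof -
  have Ms: "is_struct K M" using M by (simp add: models_def)
  obtain N :: "('g, 's, nat) struct" and g where
    N: "is_struct K N" and g: "g ` carrier N \<subseteq> carrier M" "A \<subseteq> g ` carrier N"
    and op': "\<And>i xs. set xs \<subseteq> g ` carrier N \<Longrightarrow> op i xs \<in> g ` carrier N"
    and el: "\<And>\<phi> e. wf_fm K \<phi> \<Longrightarrow> range e \<subseteq> carrier N \<Longrightarrow> sat N e \<phi> = sat M (g \<circ> e) \<phi>"
    by (rule loewenheim_skolem[OF Ms A, of op, OF op], assumption) (rule that; assumption)
  have ho: "holds N \<phi> xs = holds M \<phi> (map g xs)"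
    if "fm_of_arity K (length xs) \<phi>" "set xs \<subseteq> carrier N" for \<phi> xs
    using holds_elementary[OF N el that] by blast
  have dom: "x \<in> int_dom I N \<longleftrightarrow> g x \<in> int_dom I M" if "x \<in> carrier N" for x
    using ho[of "[x]" "dom_fm I"] I that g(1) by (auto simp: int_dom_def wf_interp_def)
  show thesis
  proof (rule that[OF _ g op' ho dom])
    show "models K N T"
      unfolding models_def
    proof (intro conjI ballI allI impI N)
      fix \<phi> and e :: "nat \<Rightarrow> nat" assume "\<phi> \<in> T" "range e \<subseteq> carrier N"
      moreover from this g(1) have "range (g \<circ> e) \<subseteq> carrier M" by auto
      ultimately show "sat N e \<phi>" using el M T by (auto simp: models_def)
    qed
    show "(x, y) \<in> int_eq I N \<longleftrightarrow> (g x, g y) \<in> int_eq I M"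
      if "x \<in> carrier N" "y \<in> carrier N" for x y
      using ho[of "[x, y]" "eq_fm I"] I that dom
      by (auto simp: int_eq_def wf_interp_def numeral_2_eq_2)
  qed
qed

lemma list_preimage:
  assumes "set xs \<subseteq> g ` C"
  obtains ns where "xs = map g ns" "set ns \<subseteq> C"
proof -
  have "xs \<in> lists (g ` C)" using assms by auto
  then show thesis using that unfolding lists_image by auto
qed

lemma defines_any_type:
  fixes M :: "('g::countable, 's::countable, 'm) struct"
    and I :: "('f, 'r, 'g, 's) interp"
  assumes int: "is_interpretation TYPE(nat) K T L S I"
    and T: "\<forall>\<phi>\<in>T. wf_fm K \<phi>" and M: "models K M T"
  shows "defines_struct L I M"
proof -
  let ?D = "int_dom I M" and ?E = "int_eq I M"
  have I: "wf_interp L K I" using int by (simp add: is_interpretation_def)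
  obtain a where a: "a \<in> carrier M" using M by (auto simp: models_def is_struct_def)
  have DC: "?D \<subseteq> carrier M" by (auto simp: int_dom_def)
  have ED: "?E \<subseteq> ?D \<times> ?D" by (auto simp: int_eq_def)
  have sub: "\<exists>(N :: ('g, 's, nat) struct) g. defines_struct L I N \<and>
    g ` carrier N \<subseteq> carrier M \<and> A \<subseteq> g ` carrier N \<and>
    (\<forall>\<phi> xs. fm_of_arity K (length xs) \<phi> \<longrightarrow> set xs \<subseteq> carrier N \<longrightarrow>
       holds N \<phi> xs = holds M \<phi> (map g xs)) \<and>
    (\<forall>x\<in>carrier N. x \<in> int_dom I N \<longleftrightarrow> g x \<in> ?D) \<and>
    (\<forall>x\<in>carrier N. \<forall>y\<in>carrier N. (x, y) \<in> int_eq I N \<longleftrightarrow> (g x, g y) \<in> ?E)"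
    if A: "finite A" "A \<subseteq> carrier M" for A
  proof -
    obtain N :: "('g, 's, nat) struct" and g where
      "models K N T" "g ` carrier N \<subseteq> carrier M" "A \<subseteq> g ` carrier N"
      "\<And>\<phi> xs. fm_of_arity K (length xs) \<phi> \<Longrightarrow> set xs \<subseteq> carrier N \<Longrightarrow>
         holds N \<phi> xs = holds M \<phi> (map g xs)"
      "\<And>x. x \<in> carrier N \<Longrightarrow> x \<in> int_dom I N \<longleftrightarrow> g x \<in> ?D"
      "\<And>x y. x \<in> carrier N \<Longrightarrow> y \<in> carrier N \<Longrightarrow> (x, y) \<in> int_eq I N \<longleftrightarrow> (g x, g y) \<in> ?E"
      by (rule submodel[OF M T I countable_finite[OF A(1)] A(2), of "\<lambda>(_::unit) _. a"], rule a)
         (rule that; assumption)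
    moreover from this(1) have "defines_struct L I N"
      using int by (simp add: is_interpretation_def)
    ultimately show ?thesis by blast
  qed
  have domC: "int_dom I N \<subseteq> carrier N" for N :: "('g, 's, nat) struct"
    by (auto simp: int_dom_def)
  have ne: "?D \<noteq> {}"
  proof -
    have fin: "finite ({})" and sC: "{} \<subseteq> carrier M" by auto
    obtain N :: "('g, 's, nat) struct" and g where
      d: "defines_struct L I N" and "\<forall>x\<in>carrier N. x \<in> int_dom I N \<longleftrightarrow> g x \<in> ?D"
      using sub[OF fin sC] by (elim exE conjE) (rule that; assumption)
    moreover obtain x where "x \<in> int_dom I N" using d by (auto simp: defines_struct_def)
    ultimately show ?thesis using domC by blast
  qed
  have refl: "(x, x) \<in> ?E" if x: "x \<in> ?D" for x
  proof -
    have fin: "finite ({x})" and sC: "{x} \<subseteq> carrier M" using x DC by auto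
    obtain N :: "('g, 's, nat) struct" and g where
      d: "defines_struct L I N" and A: "{x} \<subseteq> g ` carrier N"
      and D: "\<forall>x\<in>carrier N. x \<in> int_dom I N \<longleftrightarrow> g x \<in> ?D"
      and E: "\<forall>x\<in>carrier N. \<forall>y\<in>carrier N. (x, y) \<in> int_eq I N \<longleftrightarrow> (g x, g y) \<in> ?E"
      using sub[OF fin sC] by (elim exE conjE) (rule that; assumption)
    obtain n where n: "n \<in> carrier N" "x = g n" using A by auto
    then have "n \<in> int_dom I N" using D x by simp
    then have "(n, n) \<in> int_eq I N"
      using d by (auto simp: defines_struct_def equiv_def dest: refl_onD)
    then show ?thesis using E n by simp
  qed
  have sym: "(y, x) \<in> ?E" if xy: "(x, y) \<in> ?E" for x y
  proof -
    have fin: "finite ({x, y})" and sC: "{x, y} \<subseteq> carrier M" using xy ED DC by auto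
    obtain N :: "('g, 's, nat) struct" and g where
      d: "defines_struct L I N" and A: "{x, y} \<subseteq> g ` carrier N"
      and E: "\<forall>x\<in>carrier N. \<forall>y\<in>carrier N. (x, y) \<in> int_eq I N \<longleftrightarrow> (g x, g y) \<in> ?E"
      using sub[OF fin sC] by (elim exE conjE) (rule that; assumption)
    obtain n m where n: "n \<in> carrier N" "x = g n" "m \<in> carrier N" "y = g m" using A by auto
    then have "(n, m) \<in> int_eq I N" using E xy by simp
    then have "(m, n) \<in> int_eq I N"
      using d by (auto simp: defines_struct_def equiv_def dest: symD)
    then show ?thesis using E n by simp
  qed
  have trans: "(x, z) \<in> ?E" if xyz: "(x, y) \<in> ?E" "(y, z) \<in> ?E" for x y z
  proof -
    have fin: "finite ({x, y, z})" and sC: "{x, y, z} \<subseteq> carrier M" using xyz ED DC by auto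
    obtain N :: "('g, 's, nat) struct" and g where
      d: "defines_struct L I N" and A: "{x, y, z} \<subseteq> g ` carrier N"
      and E: "\<forall>x\<in>carrier N. \<forall>y\<in>carrier N. (x, y) \<in> int_eq I N \<longleftrightarrow> (g x, g y) \<in> ?E"
      using sub[OF fin sC] by (elim exE conjE) (rule that; assumption)
    obtain n m k where n: "n \<in> carrier N" "x = g n" "m \<in> carrier N" "y = g m"
      "k \<in> carrier N" "z = g k" using A by auto
    then have "(n, m) \<in> int_eq I N" "(m, k) \<in> int_eq I N" using E xyz by simp_all
    then have "(n, k) \<in> int_eq I N"
      using d unfolding defines_struct_def equiv_def by (meson transD)
    then show ?thesis using E n by simp
  qed
  have equiv: "equiv ?D ?E"
    by (intro equivI refl_onI symI transI) (fact ED | erule refl sym | rule trans; assumption)+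
  have resp: "respects_eq ?E n (holds M \<phi>)"
    if \<phi>: "fm_of_arity K n \<phi>"
      and r: "\<And>N :: ('g, 's, nat) struct. defines_struct L I N \<Longrightarrow>
                respects_eq (int_eq I N) n (holds N \<phi>)" for n \<phi>
    unfolding respects_eq_def
  proof (intro allI impI)
    fix xs ys assume *: "length xs = n \<and> list_all2 (\<lambda>x y. (x, y) \<in> ?E) xs ys"
    then have "set xs \<union> set ys \<subseteq> carrier M"
      using ED DC by (fastforce simp: list_all2_conv_all_nth in_set_conv_nth)
    then have fin: "finite (set xs \<union> set ys)" and sC: "set xs \<union> set ys \<subseteq> carrier M" by auto
    obtain N :: "('g, 's, nat) struct" and g where
      d: "defines_struct L I N" and A: "set xs \<union> set ys \<subseteq> g ` carrier N"
      and ho: "\<forall>\<phi> xs. fm_of_arity K (length xs) \<phi> \<longrightarrow> set xs \<subseteq> carrier N \<longrightarrow>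
         holds N \<phi> xs = holds M \<phi> (map g xs)"
      and E: "\<forall>x\<in>carrier N. \<forall>y\<in>carrier N. (x, y) \<in> int_eq I N \<longleftrightarrow> (g x, g y) \<in> ?E"
      using sub[OF fin sC] by (elim exE conjE) (rule that; assumption)
    obtain ns where ns: "xs = map g ns" "set ns \<subseteq> carrier N" using A list_preimage[of xs g] by auto
    obtain ms where ms: "ys = map g ms" "set ms \<subseteq> carrier N" using A list_preimage[of ys g] by auto
    have len: "length ns = n" "length ms = n"
      using * ns(1) ms(1) by (auto dest: list_all2_lengthD)
    have "list_all2 (\<lambda>x y. (x, y) \<in> int_eq I N) ns ms"
      using * E ns ms len by (auto simp: list_all2_conv_all_nth subset_iff)
    then have "holds N \<phi> ns = holds N \<phi> ms"
      by (rule respects_eqD[OF r[OF d] len(1)])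
    then show "holds M \<phi> xs = holds M \<phi> ys"
      using ho \<phi> ns ms len by simp
  qed
  have tot: "\<exists>y\<in>?D. holds M (fn_fm I f) (xs @ [y])"
    and uniq: "\<And>y z. y \<in> ?D \<Longrightarrow> z \<in> ?D \<Longrightarrow> holds M (fn_fm I f) (xs @ [y]) \<Longrightarrow>
      holds M (fn_fm I f) (xs @ [z]) \<Longrightarrow> (y, z) \<in> ?E"
    if f: "funs L f = Some (length xs)" and xs: "set xs \<subseteq> ?D" for f xs
  proof -
    have ar: "fm_of_arity K (Suc (length xs)) (fn_fm I f)" using I f by (simp add: wf_interp_def)
    {
      have fin: "finite (set xs)" and sC: "set xs \<subseteq> carrier M" using xs DC by auto
      obtain N :: "('g, 's, nat) struct" and g where
        d: "defines_struct L I N" and A: "set xs \<subseteq> g ` carrier N"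
        and ho: "\<forall>\<phi> xs. fm_of_arity K (length xs) \<phi> \<longrightarrow> set xs \<subseteq> carrier N \<longrightarrow>
           holds N \<phi> xs = holds M \<phi> (map g xs)"
        and D: "\<forall>x\<in>carrier N. x \<in> int_dom I N \<longleftrightarrow> g x \<in> ?D"
        using sub[OF fin sC] by (elim exE conjE) (rule that; assumption)
      obtain ns where ns: "xs = map g ns" "set ns \<subseteq> carrier N" using A list_preimage by blast
      have "set ns \<subseteq> int_dom I N" using ns xs D by auto
      then obtain m where "m \<in> int_dom I N" "holds N (fn_fm I f) (ns @ [m])"
        using d f ns(1) unfolding defines_struct_def by auto metis
      moreover from this have "m \<in> carrier N" using domC by blast
      ultimately show "\<exists>y\<in>?D. holds M (fn_fm I f) (xs @ [y])"
        using ho ar ns D by (auto intro!: bexI[of _ "g m"])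
    }
    fix y z assume yz: "y \<in> ?D" "z \<in> ?D"
      "holds M (fn_fm I f) (xs @ [y])" "holds M (fn_fm I f) (xs @ [z])"
    have fin: "finite (set xs \<union> {y, z})" and sC: "set xs \<union> {y, z} \<subseteq> carrier M" using xs yz DC by auto
    obtain N :: "('g, 's, nat) struct" and g where
      d: "defines_struct L I N" and A: "set xs \<union> {y, z} \<subseteq> g ` carrier N"
      and ho: "\<forall>\<phi> xs. fm_of_arity K (length xs) \<phi> \<longrightarrow> set xs \<subseteq> carrier N \<longrightarrow>
         holds N \<phi> xs = holds M \<phi> (map g xs)"
      and D: "\<forall>x\<in>carrier N. x \<in> int_dom I N \<longleftrightarrow> g x \<in> ?D"
      and E: "\<forall>x\<in>carrier N. \<forall>y\<in>carrier N. (x, y) \<in> int_eq I N \<longleftrightarrow> (g x, g y) \<in> ?E"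
      using sub[OF fin sC] by (elim exE conjE) (rule that; assumption)
    obtain ns where ns: "xs = map g ns" "set ns \<subseteq> carrier N" using A list_preimage[of xs g] by auto
    obtain n m where nm: "n \<in> carrier N" "y = g n" "m \<in> carrier N" "z = g m" using A by auto
    have sD: "set ns \<subseteq> int_dom I N" using ns xs D by auto
    have nmD: "n \<in> int_dom I N" "m \<in> int_dom I N" using nm yz D by auto
    have h: "holds N (fn_fm I f) (ns @ [n])" "holds N (fn_fm I f) (ns @ [m])"
      using ho ar ns nm yz by auto
    have eq: "equiv (int_dom I N) (int_eq I N)" using d by (simp add: defines_struct_def)
    obtain k where "\<forall>z\<in>int_dom I N. holds N (fn_fm I f) (ns @ [z]) \<longrightarrow> (k, z) \<in> int_eq I N"
      using d f ns(1) sD unfolding defines_struct_def by auto metis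
    then have "(k, n) \<in> int_eq I N" "(k, m) \<in> int_eq I N" using h nmD by auto
    then have "(n, m) \<in> int_eq I N" using eq by (meson equivE symE transE)
    then show "(y, z) \<in> ?E" using E nm by simp
  qed
  show ?thesis
    unfolding defines_struct_def
  proof (intro conjI allI impI)
    show "?D \<noteq> {}" by (rule ne)
    show "equiv ?D ?E" by (rule equiv)
    show "respects_eq ?E n (holds M (rl_fm I r))" if "rels L r = Some n" for r n
      by (rule resp) (use I that in \<open>auto simp: wf_interp_def defines_struct_def\<close>)
    show "respects_eq ?E (Suc n) (holds M (fn_fm I f))" if "funs L f = Some n" for f n
      by (rule resp) (use I that in \<open>auto simp: wf_interp_def defines_struct_def\<close>)
    fix f n xs assume f: "funs L f = Some n" and "length xs = n \<and> set xs \<subseteq> ?D"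
    then have xs: "funs L f = Some (length xs)" "set xs \<subseteq> ?D" by auto
    show "\<exists>y\<in>?D. holds M (fn_fm I f) (xs @ [y]) \<and>
            (\<forall>z\<in>?D. holds M (fn_fm I f) (xs @ [z]) \<longrightarrow> (y, z) \<in> ?E)"
      using tot[OF xs] uniq[OF xs] by blast
  qed
qed

theorem is_interpretation_any_type:
  fixes I :: "('f::countable, 'r::countable, 'g::countable, 's::countable) interp"
  assumes int: "is_interpretation TYPE(nat) K T L S I"
    and T: "\<forall>\<phi>\<in>T. wf_fm K \<phi>" and S: "\<forall>\<phi>\<in>S. wf_fm L \<phi>"
  shows "is_interpretation TYPE('m) K T L S I"
proof -
  have I: "wf_interp L K I" using int by (simp add: is_interpretation_def)
  have "models L (quot_struct I M) S" if M: "models K M T" for M :: "('g, 's, 'm) struct"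
  proof -
    let ?D = "int_dom I M" and ?E = "int_eq I M" and ?Q = "quot_struct I M"
    let ?cl = "\<lambda>x. ?E `` {x}"
    have d: "defines_struct L I M" by (rule defines_any_type[OF int T M])
    then have E: "equiv ?D ?E" and "?D \<noteq> {}" by (auto simp: defines_struct_def)
    then obtain a where a: "a \<in> ?D" by auto
    have DC: "?D \<subseteq> carrier M" by (auto simp: int_dom_def)
    have Qc: "carrier ?Q = ?cl ` ?D" by (auto simp: quot_struct_def quotient_def)
    define op :: "('f, 'r) fm \<Rightarrow> 'm list \<Rightarrow> 'm" where
      "op \<phi> xs = choose_witness a ?D (\<lambda>y. sat ?Q (case_nat (?cl y) ((!) (map ?cl xs))) \<phi>)" for \<phi> xs
    have opD: "op \<phi> xs \<in> ?D" for \<phi> xs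
      unfolding op_def by (rule choose_witness_in[OF a])
    then have opC: "op \<phi> xs \<in> carrier M" for \<phi> xs using DC by blast
    have "sat ?Q e \<phi>" if \<phi>: "\<phi> \<in> S" and e: "range e \<subseteq> carrier ?Q" for e \<phi>
    proof -
      have "\<forall>i. \<exists>x\<in>?D. e i = ?cl x" using e unfolding Qc by blast
      then obtain e0 where e0: "\<And>i. e0 i \<in> ?D" "\<And>i. e i = ?cl (e0 i)" by metis
      have A: "countable (range e0)" "range e0 \<subseteq> carrier M" using e0 DC by auto
      obtain N :: "('g, 's, nat) struct" and g where
        N: "models K N T" and g: "g ` carrier N \<subseteq> carrier M" "range e0 \<subseteq> g ` carrier N"
        and op: "\<And>\<phi> xs. set xs \<subseteq> g ` carrier N \<Longrightarrow> op \<phi> xs \<in> g ` carrier N"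
        and ho: "\<And>\<phi> xs. fm_of_arity K (length xs) \<phi> \<Longrightarrow> set xs \<subseteq> carrier N \<Longrightarrow>
           holds N \<phi> xs = holds M \<phi> (map g xs)"
        and D: "\<And>x. x \<in> carrier N \<Longrightarrow> x \<in> int_dom I N \<longleftrightarrow> g x \<in> ?D"
        and Eq: "\<And>x y. x \<in> carrier N \<Longrightarrow> y \<in> carrier N \<Longrightarrow>
           (x, y) \<in> int_eq I N \<longleftrightarrow> (g x, g y) \<in> ?E"
        by (rule submodel[OF M T I A, of op, OF opC]) (rule that; assumption)
      let ?D' = "int_dom I N" and ?E' = "int_eq I N" and ?R = "quot_struct I N"
      let ?cl' = "\<lambda>x. ?E' `` {x}"
      have d': "defines_struct L I N" and R: "models L ?R S"
        using int N by (auto simp: is_interpretation_def)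
      then have E': "equiv ?D' ?E'" by (auto simp: defines_struct_def)
      have DC': "?D' \<subseteq> carrier N" by (auto simp: int_dom_def)
      have gD: "g x \<in> ?D" if "x \<in> ?D'" for x using D that DC' by auto
      have Rc: "carrier ?R = ?cl' ` ?D'" by (auto simp: quot_struct_def quotient_def)
      have cleq: "?cl' x = ?cl' y \<longleftrightarrow> ?cl (g x) = ?cl (g y)" if "x \<in> ?D'" "y \<in> ?D'" for x y
        using that gD Eq DC' eq_equiv_class_iff[OF E'] eq_equiv_class_iff[OF E] by (simp add: subset_iff)
      define h where "h X = ?cl (g (SOME x. x \<in> ?D' \<and> X = ?cl' x))" for X
      have h: "h (?cl' x) = ?cl (g x)" if "x \<in> ?D'" for x
      proof -
        let ?y = "SOME y. y \<in> ?D' \<and> ?cl' x = ?cl' y"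
        have "?y \<in> ?D' \<and> ?cl' x = ?cl' ?y" by (rule someI[of _ x]) (use that in auto)
        then show ?thesis using cleq that unfolding h_def by blast
      qed
      have reps: "\<exists>xs. Xs = map ?cl' xs \<and> set xs \<subseteq> ?D' \<and> map h Xs = map ?cl (map g xs)"
        if "set Xs \<subseteq> carrier ?R" for Xs
      proof -
        have "set Xs \<subseteq> ?cl' ` ?D'" using that by (simp only: Rc)
        then obtain xs where xs: "Xs = map ?cl' xs" "set xs \<subseteq> ?D'"
          by (rule list_preimage)
        moreover have "map h (map ?cl' xs) = map ?cl (map g xs)" using xs(2) h by auto
        ultimately show ?thesis by (intro exI[of _ xs]) simp
      qed
      have sat_eq: "sat ?R e' \<phi> = sat ?Q (h \<circ> e') \<phi>" if e': "range e' \<subseteq> carrier ?R" for e'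
      proof (rule tarski_vaught[OF quot_is_struct[OF d'] _ _ _ _ _ _ e'])
        show "inj_on h (carrier ?R)" unfolding Rc by (auto simp: inj_on_def h cleq)
        show "h ` carrier ?R \<subseteq> carrier ?Q" unfolding Rc Qc using h gD by auto
        show "wf_fm L \<phi>" using S \<phi> by blast
      next
        fix f Xs assume f: "funs L f = Some (length Xs)" and "set Xs \<subseteq> carrier ?R"
        then obtain xs where xs: "Xs = map ?cl' xs" "set xs \<subseteq> ?D'"
          and hXs: "map h Xs = map ?cl (map g xs)" using reps by blast
        have f': "funs L f = Some (length xs)" using f xs by simp
        obtain y where y: "y \<in> ?D'" "holds N (fn_fm I f) (xs @ [y])"
          using d' f' xs(2) unfolding defines_struct_def by auto metis
        have yC: "y \<in> carrier N" "set xs \<subseteq> carrier N" using y xs DC' by auto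
        have "fm_of_arity K (Suc (length xs)) (fn_fm I f)" using I f' by (simp add: wf_interp_def)
        then have "holds M (fn_fm I f) (map g xs @ [g y])"
          using ho[of "xs @ [y]" "fn_fm I f"] y yC by simp
        then have "fn ?Q f (map ?cl (map g xs)) = ?cl (g y)"
          using quot_fn[OF d, of f "map g xs" "g y"] f' gD xs(2) y(1) by auto
        moreover have "fn ?R f Xs = ?cl' y" unfolding xs(1) by (rule quot_fn[OF d' f' xs(2) y])
        ultimately show "h (fn ?R f Xs) = fn ?Q f (map h Xs)"
          unfolding hXs using h[OF y(1)] by simp
      next
        fix r Xs assume r: "rels L r = Some (length Xs)" and "set Xs \<subseteq> carrier ?R"
        then obtain xs where xs: "Xs = map ?cl' xs" "set xs \<subseteq> ?D'"
          and hXs: "map h Xs = map ?cl (map g xs)" using reps by blast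
        have r': "rels L r = Some (length xs)" using r xs by simp
        have "rl ?R r Xs = holds N (rl_fm I r) xs"
          unfolding xs(1) by (rule quot_rl[OF d' r' xs(2)])
        also have "\<dots> = holds M (rl_fm I r) (map g xs)"
          by (rule ho) (use I r' xs DC' in \<open>auto simp: wf_interp_def\<close>)
        also have "\<dots> = rl ?Q r (map h Xs)"
          unfolding hXs by (rule quot_rl[OF d, symmetric]) (use r' xs gD in auto)
        finally show "rl ?R r Xs = rl ?Q r (map h Xs)" .
      next
        fix \<psi> :: "('f, 'r) fm" and u y
        assume u: "range u \<subseteq> carrier ?R" and y: "y \<in> carrier ?Q"
          and s: "sat ?Q (case_nat y (h \<circ> u)) \<psi>"
        obtain n where n: "\<And>i. i \<in> fv \<psi> \<Longrightarrow> i < n" using fv_bound by blast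
        have n': "i < n" if "Suc i \<in> fv \<psi>" for i using n[OF that] by simp
        have "set (map u [0..<n]) \<subseteq> carrier ?R" using u by auto
        then obtain xs where xs: "set xs \<subseteq> ?D'" "map h (map u [0..<n]) = map ?cl (map g xs)"
          using reps by blast
        have eq: "sat ?Q (case_nat z ((!) (map ?cl (map g xs)))) \<psi> = sat ?Q (case_nat z (h \<circ> u)) \<psi>"
          for z
          using sat_case_nat_list[of \<psi> n ?Q z "h \<circ> u"] n' unfolding xs(2)[symmetric] by simp
        obtain y0 where y0: "y0 \<in> ?D" "y = ?cl y0" using y Qc by auto
        let ?w = "op \<psi> (map g xs)"
        have "sat ?Q (case_nat (?cl ?w) ((!) (map ?cl (map g xs)))) \<psi>"
          unfolding op_def
          by (rule choose_witness[of y0 ?D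
                "\<lambda>y. sat ?Q (case_nat (?cl y) ((!) (map ?cl (map g xs)))) \<psi>"])
             (use y0 s eq in auto)
        then have sw: "sat ?Q (case_nat (?cl ?w) (h \<circ> u)) \<psi>" using eq by simp
        have "?w \<in> g ` carrier N" by (rule op) (use xs DC' in auto)
        then obtain x where x: "x \<in> carrier N" "g x = ?w" by auto
        then have "x \<in> ?D'" using D opD by simp
        then have "?cl' x \<in> carrier ?R" "h (?cl' x) = ?cl ?w" using Rc h x by auto
        then show "\<exists>x\<in>carrier ?R. sat ?Q (case_nat (h x) (h \<circ> u)) \<psi>"
          using sw by metis
      qed
      have "\<forall>i. \<exists>n\<in>carrier N. g n = e0 i" using g(2) by (auto simp: image_iff subset_iff) metis
      then obtain e1 where e1: "\<And>i. e1 i \<in> carrier N" "\<And>i. g (e1 i) = e0 i" by metis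
      then have e1D: "e1 i \<in> ?D'" for i using D e0(1) by simp
      let ?e' = "\<lambda>i. ?cl' (e1 i)"
      have "range ?e' \<subseteq> carrier ?R" using e1D Rc by auto
      then have "sat ?R ?e' \<phi>" "sat ?R ?e' \<phi> = sat ?Q (h \<circ> ?e') \<phi>"
        using R \<phi> sat_eq by (auto simp: models_def)
      moreover have "h \<circ> ?e' = e" using h[OF e1D] e1 e0 by (auto simp: fun_eq_iff)
      ultimately show ?thesis by simp
    qed
    then show ?thesis using quot_is_struct[OF d] by (simp add: models_def)
  qed
  moreover have "defines_struct L I M" if "models K M T" for M :: "('g, 's, 'm) struct"
    by (rule defines_any_type[OF int T that])
  ultimately show ?thesis using I by (simp add: is_interpretation_def)
qed

text \<open>The theories at hand meet the requirements of \<open>is_interpretation_any_type\<close>.\<close>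

instance set_rel :: countable by countable_datatype
instance pa_fun :: countable by countable_datatype

lemma wf_subst_tm: "wf_tm L t \<Longrightarrow> (\<And>i. wf_tm L (\<sigma> i)) \<Longrightarrow> wf_tm L (subst_tm \<sigma> t)"
  by (induction t) auto

lemma wf_subst: "wf_fm L \<phi> \<Longrightarrow> (\<And>i. wf_tm L (\<sigma> i)) \<Longrightarrow> wf_fm L (subst \<sigma> \<phi>)"
proof (induction \<phi> arbitrary: \<sigma>)
  case (All \<phi>)
  have "wf_tm L (lift_subst \<sigma> i)" for i
    using All.prems(2) by (auto simp: lift_subst_def wf_subst_tm split: nat.split)
  then show ?case using All.IH All.prems(1) by simp
next
  case (Ex \<phi>)
  have "wf_tm L (lift_subst \<sigma> i)" for i
    using Ex.prems(2) by (auto simp: lift_subst_def wf_subst_tm split: nat.split)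
  then show ?case using Ex.IH Ex.prems(1) by simp
qed (auto simp: wf_subst_tm)

lemma wf_Delta0: "Delta0 \<phi> \<Longrightarrow> wf_fm L_set \<phi>"
  by (induction rule: Delta0.induct) (auto simp: L_set_def)

lemma wf_set_theories: "\<forall>\<phi>\<in>ReS0 \<union> Foundation \<union> Repl. wf_fm L_set \<phi>"
proof -
  have "wf_fm L_set (Mem i j)" for i j by (simp add: L_set_def)
  then show ?thesis
    by (auto simp: ReS0_def Foundation_def Repl_def extensionality_ax_def empty_set_ax_def
        pairing_ax_def set_difference_ax_def union_ax_def separation_ax_def foundation_ax_def
        replacement_ax_def wf_Delta0 intro!: wf_subst simp del: wf_fm.simps(2))
qed

lemma wf_PA: "\<forall>\<phi>\<in>PA. wf_fm L_PA \<phi>"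
  by (auto simp: PA_def induction_ax_def L_PA_def intro!: wf_subst split: nat.split)


end

theory Submission
  imports Defs
begin

text \<open>Numbers are interpreted as finite von Neumann ordinals, with true equality. Both theories
  prove the least number principle for all formulas: Foundation gives it directly, and Replacement
  gives enough separation to turn a counterexample below \<open>n\<close> into a set, which then has an
  \<open>\<in>\<close>-minimal element by the definition of a number. Neither Infinity nor recursively defined
  functions on a domain are needed for sum and product: \<open>m + n = k\<close> is witnessed by a set of
  pairs that contains \<open>(n, k)\<close> and in which every pair is justified by the recursion equations
  from an earlier pair. Such a witness is extended by adjoining one pair, and full induction
  shows that the relation is total and functional.\<close>

section \<open>Semantics of substitution\<close>

lemma tval_subst_tm: "tval M e (subst_tm \<sigma> t) = tval M (\<lambda>i. tval M e (\<sigma> i)) t"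
proof (induction t)
  case (Fn f ts)
  then have "map (tval M e) (map (subst_tm \<sigma>) ts) = map (tval M (\<lambda>i. tval M e (\<sigma> i))) ts" by auto
  then show ?case by (simp only: tval.simps subst_tm.simps)
qed simp

lemma tval_lift_subst:
  "(\<lambda>i. tval M (case_nat x e) (lift_subst \<sigma> i)) = case_nat x (\<lambda>i. tval M e (\<sigma> i))"
  by (auto simp: fun_eq_iff lift_subst_def tval_subst_tm split: nat.split)

lemma sat_subst: "sat M e (subst \<sigma> \<phi>) = sat M (\<lambda>i. tval M e (\<sigma> i)) \<phi>"
proof (induction \<phi> arbitrary: e \<sigma>)
  case (Rel r ts)
  have "map (tval M e) (map (subst_tm \<sigma>) ts) = map (tval M (\<lambda>i. tval M e (\<sigma> i))) ts"
    by (auto simp: tval_subst_tm)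
  then show ?case by (simp only: sat.simps subst.simps)
qed (auto simp: tval_subst_tm tval_lift_subst)

lemma range_case_nat: "range (case_nat x e) \<subseteq> A \<longleftrightarrow> x \<in> A \<and> range e \<subseteq> A"
proof
  assume *: "range (case_nat x e) \<subseteq> A"
  have "case_nat x e 0 \<in> A" "case_nat x e (Suc i) \<in> A" for i using * by blast+
  then show "x \<in> A \<and> range e \<subseteq> A" by auto
qed (auto simp: image_subset_iff split: nat.splits)

section \<open>Arithmetical notions in the language of set theory\<close>

definition zero_fm :: "nat \<Rightarrow> set_fm" where
  "zero_fm i = All (Neg (Mem 0 (Suc i)))"

definition suc_fm :: "nat \<Rightarrow> nat \<Rightarrow> set_fm" where
  "suc_fm i j = All (Iff (Mem 0 (Suc j)) (Or (Mem 0 (Suc i)) (EqV 0 (Suc i))))"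

text \<open>The last conjunct, that every set meeting \<open>n \<union> {n}\<close> does so in an \<open>\<in>\<close>-minimal element,
  makes up for the lack of Foundation in the second theory.\<close>

definition num_fm :: "nat \<Rightarrow> set_fm" where
  "num_fm n =
     And (All (Imp (Mem 0 (Suc n)) (All (Imp (Mem 0 1) (Mem 0 (Suc (Suc n)))))))
    (And (All (Imp (Or (Mem 0 (Suc n)) (EqV 0 (Suc n)))
            (Or (zero_fm 0) (Ex (And (Mem 0 (Suc (Suc n))) (suc_fm 0 1))))))
         (All (Imp
            (Ex (And (Or (Mem 0 (Suc (Suc n))) (EqV 0 (Suc (Suc n)))) (Mem 0 1)))
            (Ex (And (And (Or (Mem 0 (Suc (Suc n))) (EqV 0 (Suc (Suc n)))) (Mem 0 1))
               (All (Imp (Mem 0 1) (Neg (Mem 0 2)))))))))"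

text \<open>Kuratowski's pair {{i}, {i, j}}, spelled out because the language has no terms for
  sets.\<close>

definition pair_fm :: "nat \<Rightarrow> nat \<Rightarrow> nat \<Rightarrow> set_fm" where
  "pair_fm p i j = All (Iff (Mem 0 (Suc p))
     (Or (All (Iff (Mem 0 1) (EqV 0 (Suc (Suc i)))))
         (All (Iff (Mem 0 1) (Or (EqV 0 (Suc (Suc i))) (EqV 0 (Suc (Suc j))))))))"

text \<open>\<open>(n, k)\<close> lies in a set of pairs each of which is either \<open>(0, j)\<close> with \<open>B j\<close> or
  \<open>(i + 1, j)\<close> with \<open>R j' j\<close> for some \<open>(i, j')\<close> in the set. The first argument of \<open>B\<close> and \<open>R\<close>
  is the number of quantifiers above them, by which their parameters have to be shifted.\<close>

definition rec_fm ::
  "nat \<Rightarrow> nat \<Rightarrow> (nat \<Rightarrow> nat \<Rightarrow> set_fm) \<Rightarrow> (nat \<Rightarrow> nat \<Rightarrow> nat \<Rightarrow> set_fm) \<Rightarrow> set_fm" where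
  "rec_fm n k B R =
     Ex (And (Ex (And (pair_fm 0 (Suc (Suc n)) (Suc (Suc k))) (Mem 0 1)))
       (All (Imp (Mem 0 1) (All (All (Imp (pair_fm 2 1 0)
         (Or (And (zero_fm 1) (B 4 0))
             (Ex (Ex (And (suc_fm 1 3) (And (R 6 0 2)
                (Ex (And (pair_fm 0 2 1) (Mem 0 6))))))))))))))"

text \<open>Recursion runs on the second argument: a sum starts at m and takes successors, a product
  starts at zero and adds m. The index \<open>s + m\<close> is the parameter m as seen below s
  quantifiers.\<close>

definition plus_fm :: "nat \<Rightarrow> nat \<Rightarrow> nat \<Rightarrow> set_fm" where
  "plus_fm m n k = rec_fm n k (\<lambda>s j. EqV j (s + m)) (\<lambda>s i j. suc_fm i j)"

definition times_fm :: "nat \<Rightarrow> nat \<Rightarrow> nat \<Rightarrow> set_fm" where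
  "times_fm m n k = rec_fm n k (\<lambda>s j. zero_fm j) (\<lambda>s i j. plus_fm i (s + m) j)"

lemmas arith_fm_defs = zero_fm_def suc_fm_def num_fm_def pair_fm_def rec_fm_def plus_fm_def
  times_fm_def

lemma wf_arith_fm:
  "wf_fm L_set (zero_fm i)" "wf_fm L_set (suc_fm i j)" "wf_fm L_set (num_fm i)"
  "wf_fm L_set (plus_fm i j k)" "wf_fm L_set (times_fm i j k)"
  by (simp_all add: arith_fm_defs L_set_def)

lemma fv_arith_fm:
  "fv (zero_fm i) \<subseteq> {i}" "fv (suc_fm i j) \<subseteq> {i, j}" "fv (num_fm i) \<subseteq> {i}"
  "fv (plus_fm i j k) \<subseteq> {i, j, k}" "fv (times_fm i j k) \<subseteq> {i, j, k}"
  by (auto simp: arith_fm_defs eval_nat_numeral)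

section \<open>The interpreting formulas\<close>

definition arith_interp :: "(pa_fun, unit, unit, set_rel) interp" where
  "arith_interp =
    \<lparr>dom_fm = num_fm 0, eq_fm = EqV 0 1,
     fn_fm = (\<lambda>f. case f of Zero \<Rightarrow> zero_fm 0 | Succ \<Rightarrow> suc_fm 0 1
                | Plus \<Rightarrow> plus_fm 0 1 2 | Times \<Rightarrow> times_fm 0 1 2),
     rl_fm = (\<lambda>_. EqV 0 0)\<rparr>"

lemma wf_arith_interp: "wf_interp L_PA L_set arith_interp"
  using fv_arith_fm(1)[of 0] fv_arith_fm(2)[of 0 1] fv_arith_fm(3)[of 0]
    fv_arith_fm(4,5)[of 0 1 2]
  by (auto simp: wf_interp_def fm_of_arity_def arith_interp_def wf_arith_fm L_PA_def
      split: pa_fun.splits)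

lemma funs_L_PA_cases:
  assumes "funs L_PA f = Some (length xs)"
  obtains "f = Zero" "xs = []" | m where "f = Succ" "xs = [m]"
    | m n where "f = Plus" "xs = [m, n]" | m n where "f = Times" "xs = [m, n]"
  using assms
  by (cases f) (auto simp: L_PA_def Suc_length_conv length_Suc_conv numeral_2_eq_2)

section \<open>Semantics of Foundation and Replacement\<close>

lemma sat_skip1: "sat M (case_nat z (case_nat y e)) (skip1 \<phi>) = sat M (case_nat z e) \<phi>"
  unfolding sat_subst by (rule arg_cong[where f = "\<lambda>e. sat M e \<phi>"]) (auto split: nat.split)

lemma sat_foundation_ax:
  "sat M e (foundation_ax \<phi>) \<longleftrightarrow>
    (\<exists>x\<in>carrier M. sat M (case_nat x e) \<phi>) \<longrightarrow>
    (\<exists>x\<in>carrier M. sat M (case_nat x e) \<phi> \<and>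
      (\<forall>y\<in>carrier M. rl M Elem [y, x] \<longrightarrow> \<not> sat M (case_nat y e) \<phi>))"
  unfolding foundation_ax_def sat.simps sat_skip1 by simp

lemma sat_replacement_ax:
  "sat M e (replacement_ax \<phi>) \<longleftrightarrow>
    (\<forall>x\<in>carrier M. rl M Elem [x, e 0] \<longrightarrow>
      (\<exists>y\<in>carrier M. \<forall>z\<in>carrier M. sat M (case_nat z (case_nat x e)) \<phi> \<longleftrightarrow> z = y)) \<longrightarrow>
    (\<exists>b\<in>carrier M. \<forall>y\<in>carrier M. rl M Elem [y, b] \<longleftrightarrow>
      (\<exists>x\<in>carrier M. rl M Elem [x, e 0] \<and> sat M (case_nat y (case_nat x e)) \<phi>))"
proof -
  have swap: "sat M (case_nat x (case_nat y (case_nat b e)))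
      (ren (case_nat 1 (case_nat 0 (\<lambda>i. i + 3))) \<phi>) = sat M (case_nat y (case_nat x e)) \<phi>" for x y b
    unfolding sat_subst
    by (rule arg_cong[where f = "\<lambda>e. sat M e \<phi>"])
      (auto simp: fun_eq_iff eval_nat_numeral split: nat.split)
  show ?thesis unfolding replacement_ax_def sat.simps sat_skip1 swap by (auto simp: iff_conv_conj_imp)
qed

section \<open>Numbers and recursion in a model\<close>

text \<open>The common ground of the two theories. Stating it for a structure lets the set theory be
  done with HOL quantifiers over the carrier; formulas return only where a scheme has to be
  applied.\<close>

locale set_model =
  fixes M :: "(unit, set_rel, 'm) struct"
  assumes ext: "x \<in> carrier M \<Longrightarrow> y \<in> carrier M \<Longrightarrow>
      (\<And>z. z \<in> carrier M \<Longrightarrow> rl M Elem [z, x] \<longleftrightarrow> rl M Elem [z, y]) \<Longrightarrow> x = y"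
    and ex_empty: "\<exists>x\<in>carrier M. \<forall>z\<in>carrier M. \<not> rl M Elem [z, x]"
    and ex_upair: "x \<in> carrier M \<Longrightarrow> y \<in> carrier M \<Longrightarrow>
      \<exists>p\<in>carrier M. \<forall>z\<in>carrier M. rl M Elem [z, p] \<longleftrightarrow> z = x \<or> z = y"
    and ex_diff: "x \<in> carrier M \<Longrightarrow> y \<in> carrier M \<Longrightarrow>
      \<exists>p\<in>carrier M. \<forall>z\<in>carrier M. rl M Elem [z, p] \<longleftrightarrow> rl M Elem [z, x] \<and> \<not> rl M Elem [z, y]"
    and ex_Union: "x \<in> carrier M \<Longrightarrow>
      \<exists>p\<in>carrier M. \<forall>z\<in>carrier M. rl M Elem [z, p] \<longleftrightarrow>
        (\<exists>y\<in>carrier M. rl M Elem [y, x] \<and> rl M Elem [z, y])"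
begin

abbreviation C where "C \<equiv> carrier M"

abbreviation mem (infix "\<epsilon>" 50) where "x \<epsilon> y \<equiv> rl M Elem [x, y]"

definition is_zero where "is_zero x \<longleftrightarrow> (\<forall>z\<in>C. \<not> z \<epsilon> x)"

definition is_suc where "is_suc x y \<longleftrightarrow> (\<forall>z\<in>C. z \<epsilon> y \<longleftrightarrow> z \<epsilon> x \<or> z = x)"

text \<open>The second clause excludes limits other than zero, both at n and below it. The third is
  well-foundedness of \<open>\<epsilon>\<close> on n \<union> {n}, tested only against sets of the
  model, which keeps the notion first-order.\<close>

definition num where
  "num n \<longleftrightarrow> n \<in> C \<and>
     (\<forall>y\<in>C. y \<epsilon> n \<longrightarrow> (\<forall>x\<in>C. x \<epsilon> y \<longrightarrow> x \<epsilon> n)) \<and>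
     (\<forall>y\<in>C. y \<epsilon> n \<or> y = n \<longrightarrow> is_zero y \<or> (\<exists>x\<in>C. x \<epsilon> n \<and> is_suc x y)) \<and>
     (\<forall>z\<in>C. (\<exists>x\<in>C. (x \<epsilon> n \<or> x = n) \<and> x \<epsilon> z) \<longrightarrow>
        (\<exists>x\<in>C. ((x \<epsilon> n \<or> x = n) \<and> x \<epsilon> z) \<and> (\<forall>y\<in>C. y \<epsilon> x \<longrightarrow> \<not> y \<epsilon> z)))"

definition is_pair where
  "is_pair p i j \<longleftrightarrow> (\<forall>z\<in>C. z \<epsilon> p \<longleftrightarrow>
     (\<forall>x\<in>C. x \<epsilon> z \<longleftrightarrow> x = i) \<or> (\<forall>x\<in>C. x \<epsilon> z \<longleftrightarrow> x = i \<or> x = j))"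

text \<open>Every pair in f must have its reason inside f, but f need not be single-valued or have a
  number as its domain. So adjoining one justified pair keeps f closed; uniqueness of values is left
  to induction.\<close>

definition closed where
  "closed B R f \<longleftrightarrow> (\<forall>p\<in>C. p \<epsilon> f \<longrightarrow> (\<forall>i\<in>C. \<forall>j\<in>C. is_pair p i j \<longrightarrow>
      is_zero i \<and> B j \<or>
      (\<exists>i'\<in>C. \<exists>j'\<in>C. is_suc i' i \<and> R j' j \<and> (\<exists>q\<in>C. is_pair q i' j' \<and> q \<epsilon> f))))"

definition recd where
  "recd B R n k \<longleftrightarrow> (\<exists>f\<in>C. (\<exists>p\<in>C. is_pair p n k \<and> p \<epsilon> f) \<and> closed B R f)"

definition is_plus where "is_plus m = recd (\<lambda>j. j = m) is_suc"

definition is_times where "is_times m = recd is_zero (\<lambda>i j. is_plus i m j)"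

section \<open>Meaning of the formulas in the model\<close>

lemma sat_zero_fm [simp]: "sat M e (zero_fm i) = is_zero (e i)"
  by (simp add: zero_fm_def is_zero_def)

lemma sat_suc_fm [simp]: "sat M e (suc_fm i j) = is_suc (e i) (e j)"
  by (auto simp: suc_fm_def is_suc_def)

text \<open>The premise is there because \<open>num\<close> contains membership in the carrier,
  which the formula does not express.\<close>

lemma sat_num_fm [simp]: "e n \<in> C \<Longrightarrow> sat M e (num_fm n) = num (e n)"
  by (simp add: num_fm_def num_def eval_nat_numeral)

lemma sat_pair_fm [simp]: "sat M e (pair_fm p i j) = is_pair (e p) (e i) (e j)"
  by (auto simp: pair_fm_def is_pair_def)

lemma sat_plus_fm [simp]: "sat M e (plus_fm m n k) = is_plus (e m) (e n) (e k)"
  by (simp add: plus_fm_def rec_fm_def is_plus_def recd_def closed_def eval_nat_numeral)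

lemma sat_times_fm [simp]: "sat M e (times_fm m n k) = is_times (e m) (e n) (e k)"
  by (simp add: times_fm_def rec_fm_def is_times_def recd_def closed_def eval_nat_numeral)

section \<open>Elementary set constructions\<close>

lemma ex_adjoin:
  assumes "x \<in> C" "y \<in> C"
  obtains z where "z \<in> C" "\<forall>w\<in>C. w \<epsilon> z \<longleftrightarrow> w \<epsilon> x \<or> w = y"
proof -
  \<comment> \<open>The desired set is the union of {x, {y}}, with s = {y} and p = {x, s}.\<close>
  obtain s where s: "s \<in> C" "\<forall>w\<in>C. w \<epsilon> s \<longleftrightarrow> w = y" using ex_upair[OF assms(2,2)] by auto
  obtain p where p: "p \<in> C" "\<forall>w\<in>C. w \<epsilon> p \<longleftrightarrow> w = x \<or> w = s" using ex_upair[OF assms(1) s(1)] by auto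
  obtain u where u: "u \<in> C" "\<forall>w\<in>C. w \<epsilon> u \<longleftrightarrow> (\<exists>v\<in>C. v \<epsilon> p \<and> w \<epsilon> v)"
    using ex_Union[OF p(1)] by blast
  have "w \<epsilon> u \<longleftrightarrow> w \<epsilon> x \<or> w = y" if "w \<in> C" for w
  proof -
    have "w \<epsilon> u \<longleftrightarrow> (\<exists>v\<in>C. (v = x \<or> v = s) \<and> w \<epsilon> v)" using u(2) p(2) that by simp
    also have "\<dots> \<longleftrightarrow> w \<epsilon> x \<or> w \<epsilon> s" using assms(1) s(1) by auto
    finally show ?thesis using s(2) that by simp
  qed
  then show ?thesis using u(1) that by blast
qed

text \<open>An intersection is the double difference x - (x - y).\<close>

lemma ex_inter:
  assumes "x \<in> C" "y \<in> C"
  obtains z where "z \<in> C" "\<forall>w\<in>C. w \<epsilon> z \<longleftrightarrow> w \<epsilon> x \<and> w \<epsilon> y"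
proof -
  obtain d where d: "d \<in> C" "\<forall>w\<in>C. w \<epsilon> d \<longleftrightarrow> w \<epsilon> x \<and> \<not> w \<epsilon> y" using ex_diff[OF assms] by blast
  obtain z where z: "z \<in> C" "\<forall>w\<in>C. w \<epsilon> z \<longleftrightarrow> w \<epsilon> x \<and> \<not> w \<epsilon> d"
    using ex_diff[OF assms(1) d(1)] by blast
  have "\<forall>w\<in>C. w \<epsilon> z \<longleftrightarrow> w \<epsilon> x \<and> w \<epsilon> y" using d(2) z(2) by blast
  with z(1) show ?thesis by (rule that)
qed

lemma ex_suc:
  assumes "x \<in> C"
  obtains y where "y \<in> C" "is_suc x y"
proof -
  obtain y where y: "y \<in> C" "\<forall>w\<in>C. w \<epsilon> y \<longleftrightarrow> w \<epsilon> x \<or> w = x" using ex_adjoin[OF assms assms] .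
  have "is_suc x y" unfolding is_suc_def by (rule y(2))
  with y(1) show ?thesis by (rule that)
qed

lemma suc_mem: "is_suc x y \<Longrightarrow> z \<in> C \<Longrightarrow> z \<epsilon> y \<longleftrightarrow> z \<epsilon> x \<or> z = x"
  by (simp add: is_suc_def)

lemma zero_unique: "x \<in> C \<Longrightarrow> y \<in> C \<Longrightarrow> is_zero x \<Longrightarrow> is_zero y \<Longrightarrow> x = y"
  by (rule ext) (auto simp: is_zero_def)

lemma suc_unique: "y \<in> C \<Longrightarrow> z \<in> C \<Longrightarrow> is_suc x y \<Longrightarrow> is_suc x z \<Longrightarrow> y = z"
  by (rule ext) (auto simp: is_suc_def)

lemma suc_not_zero: "x \<in> C \<Longrightarrow> is_suc x y \<Longrightarrow> \<not> is_zero y"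
  by (auto simp: is_suc_def is_zero_def)

section \<open>Ordered pairs\<close>

lemma ex_singleton_upair:
  assumes "i \<in> C" "j \<in> C"
  obtains s d where "s \<in> C" "d \<in> C" "\<forall>x\<in>C. x \<epsilon> s \<longleftrightarrow> x = i"
    "\<forall>x\<in>C. x \<epsilon> d \<longleftrightarrow> x = i \<or> x = j"
    "\<forall>p. is_pair p i j \<longleftrightarrow> (\<forall>z\<in>C. z \<epsilon> p \<longleftrightarrow> z = s \<or> z = d)"
proof -
  obtain s where s: "s \<in> C" "\<forall>x\<in>C. x \<epsilon> s \<longleftrightarrow> x = i" using ex_upair[OF assms(1,1)] by auto
  obtain d where d: "d \<in> C" "\<forall>x\<in>C. x \<epsilon> d \<longleftrightarrow> x = i \<or> x = j" using ex_upair[OF assms] by auto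
  \<comment> \<open>By Extensionality the two descriptions inside \<open>is_pair\<close> each fit
    exactly one element of the carrier, so a pair is just the unordered pair of s and d.\<close>
  have "(\<forall>x\<in>C. x \<epsilon> z \<longleftrightarrow> x = i) \<longleftrightarrow> z = s" if "z \<in> C" for z
    using s(2) by (auto intro!: ext[OF that s(1)])
  moreover have "(\<forall>x\<in>C. x \<epsilon> z \<longleftrightarrow> x = i \<or> x = j) \<longleftrightarrow> z = d" if "z \<in> C" for z
    using d(2) by (auto intro!: ext[OF that d(1)])
  ultimately have "\<forall>p. is_pair p i j \<longleftrightarrow> (\<forall>z\<in>C. z \<epsilon> p \<longleftrightarrow> z = s \<or> z = d)"
    unfolding is_pair_def by auto
  from s(1) d(1) s(2) d(2) this show ?thesis by (rule that)
qed

lemma ex_pair: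
  assumes "i \<in> C" "j \<in> C"
  obtains p where "p \<in> C" "is_pair p i j"
proof -
  obtain s d where sd: "s \<in> C" "d \<in> C" "\<forall>x\<in>C. x \<epsilon> s \<longleftrightarrow> x = i"
    "\<forall>x\<in>C. x \<epsilon> d \<longleftrightarrow> x = i \<or> x = j"
    "\<forall>p. is_pair p i j \<longleftrightarrow> (\<forall>z\<in>C. z \<epsilon> p \<longleftrightarrow> z = s \<or> z = d)"
    using ex_singleton_upair[OF assms] .
  then obtain p where "p \<in> C" "\<forall>z\<in>C. z \<epsilon> p \<longleftrightarrow> z = s \<or> z = d" using ex_upair[of s d] by blast
  then show ?thesis using that[of p] sd(5) by simp
qed

lemma pair_inject:
  assumes C: "i \<in> C" "j \<in> C" "i' \<in> C" "j' \<in> C" and p: "is_pair p i j" "is_pair p i' j'"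
  shows "i = i' \<and> j = j'"
proof -
  obtain s d where 1: "s \<in> C" "d \<in> C" "\<forall>x\<in>C. x \<epsilon> s \<longleftrightarrow> x = i"
    "\<forall>x\<in>C. x \<epsilon> d \<longleftrightarrow> x = i \<or> x = j"
    "\<forall>p. is_pair p i j \<longleftrightarrow> (\<forall>z\<in>C. z \<epsilon> p \<longleftrightarrow> z = s \<or> z = d)"
    using ex_singleton_upair[OF C(1,2)] .
  obtain s' d' where 2: "s' \<in> C" "d' \<in> C" "\<forall>x\<in>C. x \<epsilon> s' \<longleftrightarrow> x = i'"
    "\<forall>x\<in>C. x \<epsilon> d' \<longleftrightarrow> x = i' \<or> x = j'"
    "\<forall>p. is_pair p i' j' \<longleftrightarrow> (\<forall>z\<in>C. z \<epsilon> p \<longleftrightarrow> z = s' \<or> z = d')"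
    using ex_singleton_upair[OF C(3,4)] .
  have eq: "z = s \<or> z = d \<longleftrightarrow> z = s' \<or> z = d'" if "z \<in> C" for z
    using p that by (simp add: 1(5) 2(5))
  have sd: "s = s' \<or> s = d'" "d = s' \<or> d = d'" "s' = s \<or> s' = d" "d' = s \<or> d' = d"
    using eq[OF 1(1)] eq[OF 1(2)] eq[OF 2(1)] eq[OF 2(2)] by auto
  \<comment> \<open>The first entry lies in both components of its pair, and s is one of these
    components. This identifies i' without treating i = j separately.\<close>
  have "i' \<epsilon> s'" "i' \<epsilon> d'" using bspec[OF 2(3) C(3)] bspec[OF 2(4) C(3)] by simp_all
  then have "i' \<epsilon> s" using sd(1) by auto
  then have i: "i' = i" using bspec[OF 1(3) C(3)] by simp
  have "s = s'" by (rule ext[OF 1(1) 2(1)]) (simp add: 1(3) 2(3) i)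
  then have d: "d = d'" using sd by auto
  have "j \<epsilon> d'" "j' \<epsilon> d" using bspec[OF 1(4) C(2)] bspec[OF 2(4) C(4)] d by simp_all
  then have "j = i' \<or> j = j'" "j' = i \<or> j' = j"
    using bspec[OF 2(4) C(2)] bspec[OF 1(4) C(4)] by simp_all
  then show ?thesis using i by auto
qed

section \<open>Numbers, successor and predecessor\<close>

lemma num_in: "num n \<Longrightarrow> n \<in> C"
  by (simp add: num_def)

lemma num_trans:
  assumes "num n" "y \<in> C" "x \<in> C" "x \<epsilon> y" "y \<epsilon> n"
  shows "x \<epsilon> n"
proof -
  have "\<forall>y\<in>C. y \<epsilon> n \<longrightarrow> (\<forall>x\<in>C. x \<epsilon> y \<longrightarrow> x \<epsilon> n)"
    using assms(1) unfolding num_def by (elim conjE)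
  then show ?thesis using assms(2-5) by blast
qed

lemma num_cases:
  assumes "num n" "y \<in> C" "y \<epsilon> n \<or> y = n"
  obtains "is_zero y" | x where "x \<in> C" "x \<epsilon> n" "is_suc x y"
proof -
  have "\<forall>y\<in>C. y \<epsilon> n \<or> y = n \<longrightarrow> is_zero y \<or> (\<exists>x\<in>C. x \<epsilon> n \<and> is_suc x y)"
    using assms(1) unfolding num_def by (elim conjE)
  from bspec[OF this assms(2)] assms(3) have "is_zero y \<or> (\<exists>x\<in>C. x \<epsilon> n \<and> is_suc x y)"
    by (rule mp)
  then show ?thesis using that by blast
qed

lemma num_minimal:
  assumes "num n" "z \<in> C" "x \<in> C" "x \<epsilon> n \<or> x = n" "x \<epsilon> z"
  obtains w where "w \<in> C" "w \<epsilon> n \<or> w = n" "w \<epsilon> z" "\<forall>y\<in>C. y \<epsilon> w \<longrightarrow> \<not> y \<epsilon> z"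
proof -
  have "\<forall>z\<in>C. (\<exists>x\<in>C. (x \<epsilon> n \<or> x = n) \<and> x \<epsilon> z) \<longrightarrow>
        (\<exists>x\<in>C. ((x \<epsilon> n \<or> x = n) \<and> x \<epsilon> z) \<and> (\<forall>y\<in>C. y \<epsilon> x \<longrightarrow> \<not> y \<epsilon> z))"
    using assms(1) unfolding num_def by (elim conjE)
  from bspec[OF this assms(2)]
  have "\<exists>x\<in>C. ((x \<epsilon> n \<or> x = n) \<and> x \<epsilon> z) \<and> (\<forall>y\<in>C. y \<epsilon> x \<longrightarrow> \<not> y \<epsilon> z)"
    by (rule mp) (use assms(3-5) in blast)
  then show ?thesis by (elim bexE conjE) (rule that)
qed

text \<open>Otherwise the set {x, y} would have no minimal element. The case x = y gives
  irreflexivity.\<close>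

lemma num_asym:
  assumes n: "num n" and x: "x \<in> C" "x \<epsilon> n \<or> x = n" and y: "y \<in> C" "y \<epsilon> n \<or> y = n"
  shows "\<not> (x \<epsilon> y \<and> y \<epsilon> x)"
proof
  assume xy: "x \<epsilon> y \<and> y \<epsilon> x"
  obtain z where z: "z \<in> C" "\<forall>w\<in>C. w \<epsilon> z \<longleftrightarrow> w = x \<or> w = y"
    using ex_upair[OF x(1) y(1)] by blast
  then have "x \<epsilon> z" using x(1) by simp
  from num_minimal[OF n z(1) x this] obtain w where
    w: "w \<in> C" "w \<epsilon> n \<or> w = n" "w \<epsilon> z" "\<forall>y\<in>C. y \<epsilon> w \<longrightarrow> \<not> y \<epsilon> z" .
  then have "w = x \<or> w = y" using z(2) by simp
  then show False using w(4) xy z(2) x(1) y(1) by auto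
qed

text \<open>Both x and y lie in x \<union> {x} = y \<union> {y}, so if they differed each would be
  an element of the other. Only y is assumed to be a number, since \<open>recd_suc\<close> applies
  this to a predecessor x that is merely known to lie in the carrier.\<close>

lemma suc_inject:
  assumes "num y" "x \<in> C" "is_suc x z" "is_suc y z"
  shows "x = y"
proof (rule ccontr)
  assume "x \<noteq> y"
  have y: "y \<in> C" using assms(1) by (rule num_in)
  have "x \<epsilon> y" "y \<epsilon> x"
    using suc_mem[OF assms(3,2)] suc_mem[OF assms(3) y] suc_mem[OF assms(4,2)] suc_mem[OF assms(4) y]
      \<open>x \<noteq> y\<close> by simp_all
  moreover have "x \<epsilon> y \<or> x = y" using \<open>x \<epsilon> y\<close> ..
  ultimately show False using num_asym[OF assms(1,2) _ y] by blast
qed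

lemma num_zero: "z \<in> C \<Longrightarrow> is_zero z \<Longrightarrow> num z"
  by (auto simp: num_def is_zero_def)

lemma num_suc:
  assumes n: "num n" and m: "m \<in> C" "is_suc n m"
  shows "num m"
  unfolding num_def
proof (intro conjI ballI impI)
  have nC: "n \<in> C" by (rule num_in[OF n])
  note m' = suc_mem[OF m(2)]
  show "x \<epsilon> m" if "y \<in> C" "y \<epsilon> m" "x \<in> C" "x \<epsilon> y" for x y
    using num_trans[OF n that(1,3,4)] that m'[of x] m'[of y] by auto
  show "is_zero y \<or> (\<exists>x\<in>C. x \<epsilon> m \<and> is_suc x y)" if "y \<in> C" "y \<epsilon> m \<or> y = m" for y
  proof (cases "y = m")
    case True
    then show ?thesis using m nC m'[OF nC] by blast
  next
    case False
    then have "y \<epsilon> n \<or> y = n" using that m' by simp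
    with n that(1) show ?thesis
    proof (rule num_cases)
      fix x assume "x \<in> C" "x \<epsilon> n" "is_suc x y"
      then show ?thesis using m'[of x] by blast
    qed simp
  qed
  \<comment> \<open>If z meets m = n \<union> {n}, minimality at n supplies the element. Otherwise m
    is the only candidate in z, and it is minimal because none of its elements lies in z.\<close>
  show "\<exists>x\<in>C. ((x \<epsilon> m \<or> x = m) \<and> x \<epsilon> z) \<and> (\<forall>y\<in>C. y \<epsilon> x \<longrightarrow> \<not> y \<epsilon> z)"
    if z: "z \<in> C" "\<exists>x\<in>C. (x \<epsilon> m \<or> x = m) \<and> x \<epsilon> z" for z
  proof (cases "\<exists>x\<in>C. x \<epsilon> m \<and> x \<epsilon> z")
    case True
    then obtain x where x: "x \<in> C" "x \<epsilon> m" "x \<epsilon> z" by blast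
    then have "x \<epsilon> n \<or> x = n" using m' by simp
    from num_minimal[OF n z(1) x(1) this x(3)] obtain w where
      w: "w \<in> C" "w \<epsilon> n \<or> w = n" "w \<epsilon> z" "\<forall>y\<in>C. y \<epsilon> w \<longrightarrow> \<not> y \<epsilon> z" .
    then have "w \<epsilon> m" using m' by simp
    then show ?thesis using w by blast
  next
    case False
    then show ?thesis using z(2) m(1) by blast
  qed
qed fact

text \<open>Here n = m \<union> {m}, so all clauses are inherited from n once m or n itself is
  excluded as an unwanted value. The result is what lets induction step down from a least
  counterexample.\<close>

lemma num_pred:
  assumes n: "num n" and m: "m \<in> C" "is_suc m n"
  shows "num m"
  unfolding num_def
proof (intro conjI ballI impI)
  have nC: "n \<in> C" by (rule num_in[OF n])
  note n' = suc_mem[OF m(2)]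
  have mn: "m \<epsilon> n" using n' m(1) by simp
  show "x \<epsilon> m" if xy: "y \<in> C" "y \<epsilon> m" "x \<in> C" "x \<epsilon> y" for x y
  proof -
    have yn: "y \<epsilon> n" using n' xy by simp
    then have "x \<epsilon> n" by (rule num_trans[OF n xy(1,3,4)])
    \<comment> \<open>With x = m there would be a cycle between m and y.\<close>
    moreover have "x \<noteq> m" using num_asym[OF n m(1) _ xy(1)] mn yn xy by blast
    ultimately show ?thesis using n' xy by simp
  qed
  show "is_zero y \<or> (\<exists>x\<in>C. x \<epsilon> m \<and> is_suc x y)" if y: "y \<in> C" "y \<epsilon> m \<or> y = m" for y
  proof -
    have yn: "y \<epsilon> n" using y n' by simp
    from y(1) disjI1[OF yn] show ?thesis
    proof (rule num_cases[OF n])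
      fix x assume x: "x \<in> C" "x \<epsilon> n" "is_suc x y"
      \<comment> \<open>If the predecessor of y were m, then y would be n and n would be an element
        of itself.\<close>
      have "x \<noteq> m"
      proof
        assume "x = m"
        then have "y = n" using suc_unique[OF y(1) nC] x m by blast
        then show False using num_asym[OF n nC _ nC] yn by blast
      qed
      then have "x \<epsilon> m" using x n' by simp
      then show ?thesis using x by blast
    qed simp
  qed
  show "\<exists>x\<in>C. ((x \<epsilon> m \<or> x = m) \<and> x \<epsilon> z) \<and> (\<forall>y\<in>C. y \<epsilon> x \<longrightarrow> \<not> y \<epsilon> z)"
    if z: "z \<in> C" "\<exists>x\<in>C. (x \<epsilon> m \<or> x = m) \<and> x \<epsilon> z" for z
  proof -
    \<comment> \<open>Minimality at n could return n itself. Cutting z down to n forces the minimal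
      element into n, that is, into m \<union> {m}; transitivity of n then makes it minimal in all
      of z.\<close>
    obtain r where r: "r \<in> C" "\<forall>w\<in>C. w \<epsilon> r \<longleftrightarrow> w \<epsilon> z \<and> w \<epsilon> n" using ex_inter[OF z(1) nC] .
    obtain x where x: "x \<in> C" "x \<epsilon> m \<or> x = m" "x \<epsilon> z" using z(2) by blast
    then have xn: "x \<epsilon> n" using n' by simp
    then have "x \<epsilon> r" using r x by simp
    from num_minimal[OF n r(1) x(1) disjI1[OF xn] this]
    obtain w where w: "w \<in> C" "w \<epsilon> n \<or> w = n" "w \<epsilon> r" "\<forall>y\<in>C. y \<epsilon> w \<longrightarrow> \<not> y \<epsilon> r" .
    then have wn: "w \<epsilon> n" and wz: "w \<epsilon> z" using r by auto
    have "\<not> y \<epsilon> z" if "y \<in> C" "y \<epsilon> w" for y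
    proof -
      have "y \<epsilon> n" by (rule num_trans[OF n w(1) that(1,2) wn])
      then show ?thesis using bspec[OF w(4) that(1)] bspec[OF r(2) that(1)] that(2) by simp
    qed
    moreover have "w \<epsilon> m \<or> w = m" using wn n' w(1) by simp
    ultimately show ?thesis using w(1) wz by blast
  qed
qed fact

section \<open>The recursion equations\<close>

lemma closedD:
  assumes "closed B R f" "p \<in> C" "p \<epsilon> f" "i \<in> C" "j \<in> C" "is_pair p i j"
  shows "is_zero i \<and> B j \<or>
      (\<exists>i'\<in>C. \<exists>j'\<in>C. is_suc i' i \<and> R j' j \<and> (\<exists>q\<in>C. is_pair q i' j' \<and> q \<epsilon> f))"
  using assms unfolding closed_def by blast

text \<open>A pair with first entry zero cannot be justified by a predecessor, as zero is no
  successor. Conversely, the singleton of that pair is a witness.\<close>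

lemma recd_zero:
  assumes n: "n \<in> C" "is_zero n" and k: "k \<in> C"
  shows "recd B R n k \<longleftrightarrow> B k"
proof
  assume "recd B R n k"
  then obtain f p where f: "f \<in> C" "p \<in> C" "is_pair p n k" "p \<epsilon> f" "closed B R f"
    unfolding recd_def by blast
  then have "is_zero n \<and> B k \<or> (\<exists>i\<in>C. is_suc i n)"
    using n k unfolding closed_def by blast
  then show "B k" using n suc_not_zero by blast
next
  assume B: "B k"
  obtain p where p: "p \<in> C" "is_pair p n k" using ex_pair[OF n(1) k] .
  obtain f where f: "f \<in> C" "\<forall>z\<in>C. z \<epsilon> f \<longleftrightarrow> z = p" using ex_upair[OF p(1) p(1)] by auto
  have "closed B R f"
    unfolding closed_def
  proof (intro ballI impI)
    fix r i j assume r: "r \<in> C" "r \<epsilon> f" "i \<in> C" "j \<in> C" "is_pair r i j"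
    then have "r = p" using f by simp
    then have "i = n" "j = k" using pair_inject[OF r(3,4) n(1) k, of p] r(5) p(2) by auto
    then show "is_zero i \<and> B j \<or>
      (\<exists>i'\<in>C. \<exists>j'\<in>C. is_suc i' i \<and> R j' j \<and> (\<exists>q\<in>C. is_pair q i' j' \<and> q \<epsilon> f))"
      using n(2) B by simp
  qed
  moreover have "p \<epsilon> f" using f p(1) by simp
  ultimately show "recd B R n k" unfolding recd_def using f p by blast
qed

text \<open>From left to right the witness f stays the same: the pair justifying (m, k) has first
  entry n by injectivity of the successor. From right to left, (m, k) is adjoined to f and justified
  by (n, j).\<close>

lemma recd_suc:
  assumes n: "num n" and m: "m \<in> C" "is_suc n m" and k: "k \<in> C"
  shows "recd B R m k \<longleftrightarrow> (\<exists>j\<in>C. recd B R n j \<and> R j k)"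
proof
  assume "recd B R m k"
  then obtain f p where f: "f \<in> C" "p \<in> C" "is_pair p m k" "p \<epsilon> f" "closed B R f"
    unfolding recd_def by blast
  have "\<not> is_zero m" using suc_not_zero[OF num_in[OF n] m(2)] .
  then have "\<exists>i\<in>C. \<exists>j\<in>C. is_suc i m \<and> R j k \<and> (\<exists>q\<in>C. is_pair q i j \<and> q \<epsilon> f)"
    using closedD[OF f(5,2,4) m(1) k f(3)] by simp
  then obtain i j where ij: "i \<in> C" "j \<in> C" "is_suc i m" "R j k" "\<exists>q\<in>C. is_pair q i j \<and> q \<epsilon> f"
    by blast
  have "i = n" using suc_inject[OF n ij(1,3) m(2)] .
  then have "recd B R n j" unfolding recd_def using ij(5) f(1,5) by blast
  then show "\<exists>j\<in>C. recd B R n j \<and> R j k" using ij(2,4) by blast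
next
  assume "\<exists>j\<in>C. recd B R n j \<and> R j k"
  then obtain j f q where j: "j \<in> C" "R j k" and f: "f \<in> C" "closed B R f"
    and q: "q \<in> C" "is_pair q n j" "q \<epsilon> f"
    unfolding recd_def by blast
  obtain p where p: "p \<in> C" "is_pair p m k" using ex_pair[OF m(1) k] .
  obtain g where g: "g \<in> C" "\<forall>z\<in>C. z \<epsilon> g \<longleftrightarrow> z \<epsilon> f \<or> z = p" using ex_adjoin[OF f(1) p(1)] .
  have fg: "\<exists>q\<in>C. is_pair q i j \<and> q \<epsilon> g" if "\<exists>q\<in>C. is_pair q i j \<and> q \<epsilon> f" for i j
    using that g(2) by blast
  have "closed B R g"
    unfolding closed_def
  proof (intro ballI impI)
    fix r i l assume r: "r \<in> C" "r \<epsilon> g" "i \<in> C" "l \<in> C" "is_pair r i l"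
    show "is_zero i \<and> B l \<or>
      (\<exists>i'\<in>C. \<exists>j'\<in>C. is_suc i' i \<and> R j' l \<and> (\<exists>q\<in>C. is_pair q i' j' \<and> q \<epsilon> g))"
    proof (cases "r = p")
      case True
      then have "i = m" "l = k" using pair_inject[OF r(3,4) m(1) k, of p] r(5) p(2) by auto
      moreover have "\<exists>q\<in>C. is_pair q n j \<and> q \<epsilon> g" by (rule fg) (use q in blast)
      ultimately show ?thesis using num_in[OF n] m(2) j by blast
    next
      case False
      then have "r \<epsilon> f" using bspec[OF g(2) r(1)] r(2) by simp
      from closedD[OF f(2) r(1) this r(3-5)] show ?thesis using fg by blast
    qed
  qed
  moreover have "p \<epsilon> g" using g p(1) by simp
  ultimately show "recd B R m k" unfolding recd_def using g(1) p by blast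
qed

text \<open>The HOL predicates to which the axiom schemes apply; e carries the parameters, and
  agreement is asked only on the carrier.\<close>

definition definable where
  "definable A \<longleftrightarrow> (\<exists>\<phi> e. wf_fm L_set \<phi> \<and> range e \<subseteq> C \<and> (\<forall>x\<in>C. A x \<longleftrightarrow> sat M (case_nat x e) \<phi>))"

end

section \<open>The structure of numbers\<close>

text \<open>The interface between the theories and arithmetic: this principle is all that has to be
  derived separately from Foundation and from Replacement.\<close>

locale set_induct_model = set_model M for M :: "(unit, set_rel, 'm) struct" +
  assumes least: "definable A \<Longrightarrow> num n \<Longrightarrow> A n \<Longrightarrow>
    \<exists>m. num m \<and> A m \<and> (\<forall>k. num k \<and> k \<epsilon> m \<longrightarrow> \<not> A k)"
begin

text \<open>A least counterexample m is zero or the successor of some x in m. In the second case x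
  is a number by \<open>num_pred\<close>, so it has the property and passes it on to m.\<close>

lemma num_induct:
  assumes n: "num n" and A: "definable A"
    and zero: "\<And>z. z \<in> C \<Longrightarrow> is_zero z \<Longrightarrow> A z"
    and suc: "\<And>x y. num x \<Longrightarrow> A x \<Longrightarrow> y \<in> C \<Longrightarrow> is_suc x y \<Longrightarrow> A y"
  shows "A n"
proof (rule ccontr)
  assume "\<not> A n"
  obtain \<phi> e where \<phi>: "wf_fm L_set \<phi>" "range e \<subseteq> C" "\<forall>x\<in>C. A x \<longleftrightarrow> sat M (case_nat x e) \<phi>"
    using A unfolding definable_def by blast
  have "definable (\<lambda>x. \<not> A x)"
    unfolding definable_def by (rule exI[of _ "Neg \<phi>"]) (use \<phi> in auto)
  from least[OF this n \<open>\<not> A n\<close>] obtain m where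
    m: "num m" "\<not> A m" and min: "\<And>k. num k \<Longrightarrow> k \<epsilon> m \<Longrightarrow> A k" by blast
  have mC: "m \<in> C" by (rule num_in[OF m(1)])
  have "m \<epsilon> m \<or> m = m" by simp
  with m(1) mC show False
  proof (rule num_cases)
    assume "is_zero m" then show False using zero[OF mC] m(2) by blast
  next
    fix x assume x: "x \<in> C" "x \<epsilon> m" "is_suc x m"
    have "num x" by (rule num_pred[OF m(1) x(1,3)])
    then show False using suc[OF _ min mC x(3)] x(2) m(2) by blast
  qed
qed

text \<open>Induction on n: if k is the value at n, then \<open>recd B R m\<close> is
  \<open>R k\<close> for the successor m. Uniqueness is stated over the whole carrier because the
  pairs in a witness may have arbitrary entries. Definability is a premise as B and R are arbitrary
  HOL predicates.\<close>

lemma recd_total_unique: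
  assumes n: "num n"
    and def: "definable (\<lambda>n. \<exists>k. num k \<and> (\<forall>x\<in>C. recd B R n x \<longleftrightarrow> x = k))"
    and B: "\<exists>k. num k \<and> (\<forall>x\<in>C. B x \<longleftrightarrow> x = k)"
    and R: "\<And>j. num j \<Longrightarrow> \<exists>k. num k \<and> (\<forall>x\<in>C. R j x \<longleftrightarrow> x = k)"
  shows "\<exists>k. num k \<and> (\<forall>x\<in>C. recd B R n x \<longleftrightarrow> x = k)"
  using n def
proof (rule num_induct)
  fix z assume "z \<in> C" "is_zero z"
  then show "\<exists>k. num k \<and> (\<forall>x\<in>C. recd B R z x \<longleftrightarrow> x = k)" using B recd_zero by simp
next
  fix n m assume n: "num n" and m: "m \<in> C" "is_suc n m"
  assume "\<exists>k. num k \<and> (\<forall>x\<in>C. recd B R n x \<longleftrightarrow> x = k)"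
  then obtain k where k: "num k" "\<forall>x\<in>C. recd B R n x \<longleftrightarrow> x = k" by blast
  have "recd B R m x \<longleftrightarrow> R k x" if "x \<in> C" for x
    using recd_suc[OF n m that, of B R] k(2) num_in[OF k(1)] by auto
  then show "\<exists>k. num k \<and> (\<forall>x\<in>C. recd B R m x \<longleftrightarrow> x = k)" using R[OF k(1)] by simp
qed

lemma suc_total_unique:
  assumes "num n"
  shows "\<exists>k. num k \<and> (\<forall>x\<in>C. is_suc n x \<longleftrightarrow> x = k)"
proof -
  obtain k where k: "k \<in> C" "is_suc n k" using ex_suc[OF num_in[OF assms]] .
  then show ?thesis using num_suc[OF assms k] suc_unique[OF _ k(1) _ k(2)] by blast
qed

lemma zero_total_unique: "\<exists>k. num k \<and> (\<forall>x\<in>C. is_zero x \<longleftrightarrow> x = k)"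
proof -
  obtain k where k: "k \<in> C" "is_zero k" using ex_empty unfolding is_zero_def by blast
  then show ?thesis using num_zero[OF k] zero_unique[OF _ k(1) _ k(2)] by blast
qed

lemma plus_total_unique:
  assumes m: "num m" and n: "num n"
  shows "\<exists>k. num k \<and> (\<forall>x\<in>C. is_plus m n x \<longleftrightarrow> x = k)"
  unfolding is_plus_def
proof (rule recd_total_unique[OF n])
  \<comment> \<open>Below the two quantifiers, variables 0, 1, 2, 3 are x, k, n, m; the constant
    assignment supplies the parameter m.\<close>
  show "definable (\<lambda>n. \<exists>k. num k \<and> (\<forall>x\<in>C. recd (\<lambda>j. j = m) is_suc n x \<longleftrightarrow> x = k))"
    unfolding definable_def is_plus_def[symmetric]
    by (rule exI[of _ "Ex (And (num_fm 0) (All (Iff (plus_fm 3 2 0) (EqV 0 1))))"], rule exI[of _ "\<lambda>_. m"])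
      (use m num_in in \<open>auto simp: wf_arith_fm eval_nat_numeral\<close>)
qed (use m suc_total_unique in auto)

lemma times_total_unique:
  assumes m: "num m" and n: "num n"
  shows "\<exists>k. num k \<and> (\<forall>x\<in>C. is_times m n x \<longleftrightarrow> x = k)"
  unfolding is_times_def
proof (rule recd_total_unique[OF n])
  show "definable (\<lambda>n. \<exists>k. num k \<and> (\<forall>x\<in>C. recd is_zero (\<lambda>i j. is_plus i m j) n x \<longleftrightarrow> x = k))"
    unfolding definable_def is_times_def[symmetric]
    by (rule exI[of _ "Ex (And (num_fm 0) (All (Iff (times_fm 3 2 0) (EqV 0 1))))"], rule exI[of _ "\<lambda>_. m"])
      (use m num_in in \<open>auto simp: wf_arith_fm eval_nat_numeral\<close>)
qed (use m zero_total_unique plus_total_unique in auto)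

section \<open>The arithmetical structure on the numbers\<close>

lemma fn_total_unique:
  assumes f: "funs L_PA f = Some (length xs)" and xs: "set xs \<subseteq> Collect num"
  shows "\<exists>k. num k \<and> (\<forall>x\<in>C. holds M (fn_fm arith_interp f) (xs @ [x]) \<longleftrightarrow> x = k)"
  using f
proof (cases rule: funs_L_PA_cases)
  case 1
  then show ?thesis using zero_total_unique by (simp add: arith_interp_def holds_def)
next
  case (2 n)
  then show ?thesis using xs suc_total_unique[of n] by (simp add: arith_interp_def holds_def)
next
  case (3 m n)
  then show ?thesis using xs plus_total_unique[of m n] by (simp add: arith_interp_def holds_def)
next
  case (4 m n)
  then show ?thesis using xs times_total_unique[of m n] by (simp add: arith_interp_def holds_def)
qed

text \<open>A copy of the quotient on the numbers themselves instead of their singleton classes, in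
  which PA is easier to verify. The choice is legitimate by \<open>fn_total_unique\<close>.\<close>

definition numbers :: "(pa_fun, unit, 'm) struct" where
  "numbers = \<lparr>carrier = Collect num,
     fn = (\<lambda>f xs. SOME k. num k \<and> (\<forall>x\<in>C. holds M (fn_fm arith_interp f) (xs @ [x]) \<longleftrightarrow> x = k)),
     rl = (\<lambda>_ _. False)\<rparr>"

lemma carrier_numbers [simp]: "carrier numbers = Collect num"
  by (simp add: numbers_def)

lemma fn_numbers:
  assumes "funs L_PA f = Some (length xs)" and "set xs \<subseteq> Collect num"
  shows "num (fn numbers f xs)"
    and "x \<in> C \<Longrightarrow> holds M (fn_fm arith_interp f) (xs @ [x]) \<longleftrightarrow> x = fn numbers f xs"
proof -
  have "num (fn numbers f xs) \<and>
      (\<forall>x\<in>C. holds M (fn_fm arith_interp f) (xs @ [x]) \<longleftrightarrow> x = fn numbers f xs)"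
    unfolding numbers_def struct.select_convs by (rule someI_ex[OF fn_total_unique[OF assms]])
  then show "num (fn numbers f xs)"
    and "x \<in> C \<Longrightarrow> holds M (fn_fm arith_interp f) (xs @ [x]) \<longleftrightarrow> x = fn numbers f xs"
    by blast+
qed

lemma is_struct_numbers: "is_struct L_PA numbers"
  using zero_total_unique fn_numbers(1) by (auto simp: is_struct_def)

lemma fn_numbers_iff:
  assumes "x \<in> C"
  shows "is_zero x \<longleftrightarrow> x = fn numbers Zero []"
    and "num n \<Longrightarrow> is_suc n x \<longleftrightarrow> x = fn numbers Succ [n]"
    and "num m \<Longrightarrow> num n \<Longrightarrow> is_plus m n x \<longleftrightarrow> x = fn numbers Plus [m, n]"
    and "num m \<Longrightarrow> num n \<Longrightarrow> is_times m n x \<longleftrightarrow> x = fn numbers Times [m, n]"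
  using fn_numbers(2)[of Zero "[]", OF _ _ assms] fn_numbers(2)[of Succ "[n]", OF _ _ assms]
    fn_numbers(2)[of Plus "[m, n]", OF _ _ assms] fn_numbers(2)[of Times "[m, n]", OF _ _ assms]
  by (simp_all add: L_PA_def arith_interp_def holds_def)

lemma num_fn_numbers:
  "num (fn numbers Zero [])" "num n \<Longrightarrow> num (fn numbers Succ [n])"
  "num m \<Longrightarrow> num n \<Longrightarrow> num (fn numbers Plus [m, n])"
  "num m \<Longrightarrow> num n \<Longrightarrow> num (fn numbers Times [m, n])"
  by (rule fn_numbers(1); simp add: L_PA_def)+

section \<open>Comparison with the quotient\<close>

lemma int_dom_arith: "int_dom arith_interp M = Collect num"
  using num_in by (auto simp: int_dom_def holds_def arith_interp_def)

lemma int_eq_arith: "int_eq arith_interp M = Id_on (Collect num)"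
  unfolding int_eq_def int_dom_arith by (auto simp: holds_def arith_interp_def)

lemma defines_struct_arith: "defines_struct L_PA arith_interp M"
proof -
  \<comment> \<open>Lists related entrywise by true equality are equal, so every predicate respects
    the relation.\<close>
  have "(\<lambda>x y. (x, y) \<in> Id_on (Collect num)) = (\<lambda>x y. x = y \<and> num x)" by auto
  then have resp: "respects_eq (Id_on (Collect num)) n P" for n P
    using list.rel_mono_strong[of "\<lambda>x y. x = y \<and> num x" _ _ "(=)"]
    by (auto simp: respects_eq_def list.rel_eq)
  have "equiv (Collect num) (Id_on (Collect num))"
    by (auto intro!: equivI refl_onI symI transI)
  then show ?thesis
    unfolding defines_struct_def int_dom_arith int_eq_arith
    using resp is_struct_numbers fn_numbers num_in by (auto simp: is_struct_def)
qed

text \<open>The map from x to {x} is an isomorphism onto the quotient. Its surjectivity settles the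
  witness condition of \<open>tarski_vaught\<close>.\<close>

lemma quot_numbers:
  assumes "wf_fm L_PA \<phi>" "range e \<subseteq> Collect num"
  shows "sat numbers e \<phi> = sat (quot_struct arith_interp M) ((\<lambda>x. {x}) \<circ> e) \<phi>"
proof (rule tarski_vaught[OF is_struct_numbers _ _ _ _ _ assms(1)])
  have cl: "Id_on (Collect num) `` {x} = {x}" if "num x" for x using that by auto
  have Q: "carrier (quot_struct arith_interp M) = (\<lambda>x. {x}) ` Collect num"
    using cl by (auto simp: quot_struct_def int_dom_arith int_eq_arith quotient_def)
  show "(\<lambda>x. {x}) ` carrier numbers \<subseteq> carrier (quot_struct arith_interp M)" using Q by simp
  show "{fn numbers f xs} = fn (quot_struct arith_interp M) f (map (\<lambda>x. {x}) xs)"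
    if "funs L_PA f = Some (length xs)" "set xs \<subseteq> carrier numbers" for f xs
  proof -
    have xs: "set xs \<subseteq> Collect num" using that(2) by simp
    have k: "num (fn numbers f xs)" by (rule fn_numbers(1)[OF that(1) xs])
    have "map (\<lambda>x. Id_on (Collect num) `` {x}) xs = map (\<lambda>x. {x}) xs" using xs cl by auto
    moreover have "fn (quot_struct arith_interp M) f (map (\<lambda>x. Id_on (Collect num) `` {x}) xs) =
        Id_on (Collect num) `` {fn numbers f xs}"
      using quot_fn[OF defines_struct_arith that(1), of "fn numbers f xs"] xs k
        fn_numbers(2)[OF that(1) xs num_in[OF k]]
      by (simp only: int_dom_arith int_eq_arith mem_Collect_eq)
    ultimately show ?thesis by (simp only: cl[OF k])
  qed
  show "\<exists>x\<in>carrier numbers. sat (quot_struct arith_interp M) (case_nat {x} ((\<lambda>x. {x}) \<circ> u)) \<psi>"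
    if "y \<in> carrier (quot_struct arith_interp M)"
      "sat (quot_struct arith_interp M) (case_nat y ((\<lambda>x. {x}) \<circ> u)) \<psi>" for \<psi> u y
    using that unfolding Q by auto
qed (use assms(2) in \<open>auto simp: L_PA_def\<close>)

section \<open>Translation of arithmetical terms and formulas\<close>

lemma translate_tm:
  assumes "wf_tm L_PA t"
  shows "\<exists>\<tau>. wf_fm L_set \<tau> \<and> (\<forall>e y. range e \<subseteq> Collect num \<longrightarrow> y \<in> C \<longrightarrow>
    sat M (case_nat y e) \<tau> = (y = tval numbers e t))"
  using assms
proof (induction t)
  case (Var i)
  show ?case by (rule exI[of _ "EqV 0 (Suc i)"]) simp
next
  case (Fn f ts)
  have tv: "num (tval numbers e t)" if "wf_tm L_PA t" "range e \<subseteq> Collect num" for e t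
    using tval_in[OF is_struct_numbers that(1), of e] that(2) by simp
  have 1: "(\<lambda>i. case_nat a (case_nat y e) (case_nat 0 (\<lambda>i. i + 2) i)) = case_nat a e"
    for a y :: 'm and e
    by (auto simp: fun_eq_iff split: nat.split)
  have 2: "(\<lambda>i. case_nat b (case_nat a (case_nat y e)) (case_nat 0 (\<lambda>i. i + 3) i)) = case_nat b e"
      "(\<lambda>i. case_nat b (case_nat a (case_nat y e)) (case_nat 1 (\<lambda>i. i + 3) i)) = case_nat a e"
    for a b y :: 'm and e
    by (auto simp: fun_eq_iff eval_nat_numeral split: nat.split)
  have "funs L_PA f = Some (length ts)" using Fn.prems by simp
  then show ?case
  proof (cases rule: funs_L_PA_cases)
    case 1
    then show ?thesis using fn_numbers_iff(1)
      by (intro exI[of _ "zero_fm 0"]) (simp add: wf_arith_fm)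
  next
    case (2 t)
    then have t: "ts = [t]" "wf_tm L_PA t" using Fn.prems by auto
    obtain \<tau> where \<tau>: "wf_fm L_set \<tau>" "\<And>e y. range e \<subseteq> Collect num \<Longrightarrow> y \<in> C \<Longrightarrow>
        sat M (case_nat y e) \<tau> = (y = tval numbers e t)"
      using Fn.IH[of t] t by auto
    show ?thesis
      by (rule exI[of _ "Ex (And (skip1 \<tau>) (suc_fm 0 1))"])
        (use t tv[OF t(2)] num_in in
          \<open>auto simp: 2(1) \<tau> sat_subst 1 wf_arith_fm fn_numbers_iff(2) intro!: wf_subst\<close>)
  next
    case (3 s t)
    then have t: "ts = [s, t]" "wf_tm L_PA s" "wf_tm L_PA t" using Fn.prems by auto
    obtain \<sigma> where \<sigma>: "wf_fm L_set \<sigma>" "\<And>e y. range e \<subseteq> Collect num \<Longrightarrow> y \<in> C \<Longrightarrow>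
        sat M (case_nat y e) \<sigma> = (y = tval numbers e s)"
      using Fn.IH[of s] t by auto
    obtain \<tau> where \<tau>: "wf_fm L_set \<tau>" "\<And>e y. range e \<subseteq> Collect num \<Longrightarrow> y \<in> C \<Longrightarrow>
        sat M (case_nat y e) \<tau> = (y = tval numbers e t)"
      using Fn.IH[of t] t by auto
    \<comment> \<open>Below the two quantifiers, variable 0 is the value of t, variable 1 the value
      of s, variable 2 the value y of the whole term, and the variables of the term start at 3. The
      unbounded quantifiers do no harm: the translations of s and t force their values to be
      numbers.\<close>
    show ?thesis
      by (rule exI[of _ "Ex (Ex (And (ren (case_nat 1 (\<lambda>i. i + 3)) \<sigma>)
            (And (ren (case_nat 0 (\<lambda>i. i + 3)) \<tau>) (plus_fm 1 0 2))))"])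
        (use t tv[OF t(2)] tv[OF t(3)] num_in in
          \<open>auto simp: 3(1) \<sigma> \<tau> sat_subst 2 wf_arith_fm fn_numbers_iff(3) intro!: wf_subst\<close>)
  next
    case (4 s t)
    then have t: "ts = [s, t]" "wf_tm L_PA s" "wf_tm L_PA t" using Fn.prems by auto
    obtain \<sigma> where \<sigma>: "wf_fm L_set \<sigma>" "\<And>e y. range e \<subseteq> Collect num \<Longrightarrow> y \<in> C \<Longrightarrow>
        sat M (case_nat y e) \<sigma> = (y = tval numbers e s)"
      using Fn.IH[of s] t by auto
    obtain \<tau> where \<tau>: "wf_fm L_set \<tau>" "\<And>e y. range e \<subseteq> Collect num \<Longrightarrow> y \<in> C \<Longrightarrow>
        sat M (case_nat y e) \<tau> = (y = tval numbers e t)"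
      using Fn.IH[of t] t by auto
    show ?thesis
      by (rule exI[of _ "Ex (Ex (And (ren (case_nat 1 (\<lambda>i. i + 3)) \<sigma>)
            (And (ren (case_nat 0 (\<lambda>i. i + 3)) \<tau>) (times_fm 1 0 2))))"])
        (use t tv[OF t(2)] tv[OF t(3)] num_in in
          \<open>auto simp: 4(1) \<sigma> \<tau> sat_subst 2 wf_arith_fm fn_numbers_iff(4) intro!: wf_subst\<close>)
  qed
qed

text \<open>Quantifiers are relativized to \<open>num_fm\<close>, and an equation says that both
  graphs share a value. This makes every arithmetical formula definable over the set model, so that
  \<open>num_induct\<close> covers the whole induction scheme of PA.\<close>

lemma translate_fm:
  assumes "wf_fm L_PA \<phi>"
  shows "\<exists>\<psi>. wf_fm L_set \<psi> \<and> (\<forall>e. range e \<subseteq> Collect num \<longrightarrow> sat M e \<psi> = sat numbers e \<phi>)"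
  using assms
proof (induction \<phi>)
  case (Eq s t)
  obtain \<sigma> where \<sigma>: "wf_fm L_set \<sigma>" "\<And>e y. range e \<subseteq> Collect num \<Longrightarrow> y \<in> C \<Longrightarrow>
      sat M (case_nat y e) \<sigma> = (y = tval numbers e s)"
    using translate_tm[of s] Eq by auto
  obtain \<tau> where \<tau>: "wf_fm L_set \<tau>" "\<And>e y. range e \<subseteq> Collect num \<Longrightarrow> y \<in> C \<Longrightarrow>
      sat M (case_nat y e) \<tau> = (y = tval numbers e t)"
    using translate_tm[of t] Eq by auto
  \<comment> \<open>The witness for the shared value has to come from the carrier.\<close>
  have "tval numbers e s \<in> C" if "range e \<subseteq> Collect num" for e
    using tval_in[OF is_struct_numbers, of s e] that Eq num_in by simp
  then show ?case using \<sigma> \<tau> by (intro exI[of _ "Ex (And \<sigma> \<tau>)"]) auto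
next
  case (Rel r ts)
  then show ?case by (simp add: L_PA_def)
next
  case (Neg \<phi>)
  then obtain \<psi> where "wf_fm L_set \<psi>" "\<forall>e. range e \<subseteq> Collect num \<longrightarrow> sat M e \<psi> = sat numbers e \<phi>"
    by auto
  then show ?case by (intro exI[of _ "Neg \<psi>"]) simp
next
  case (And \<phi>1 \<phi>2)
  then obtain \<psi>1 \<psi>2 where "wf_fm L_set \<psi>1" "wf_fm L_set \<psi>2"
    "\<forall>e. range e \<subseteq> Collect num \<longrightarrow> sat M e \<psi>1 = sat numbers e \<phi>1"
    "\<forall>e. range e \<subseteq> Collect num \<longrightarrow> sat M e \<psi>2 = sat numbers e \<phi>2"
    by auto
  then show ?case by (intro exI[of _ "And \<psi>1 \<psi>2"]) simp
next
  case (Or \<phi>1 \<phi>2)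
  then obtain \<psi>1 \<psi>2 where "wf_fm L_set \<psi>1" "wf_fm L_set \<psi>2"
    "\<forall>e. range e \<subseteq> Collect num \<longrightarrow> sat M e \<psi>1 = sat numbers e \<phi>1"
    "\<forall>e. range e \<subseteq> Collect num \<longrightarrow> sat M e \<psi>2 = sat numbers e \<phi>2"
    by auto
  then show ?case by (intro exI[of _ "Or \<psi>1 \<psi>2"]) simp
next
  case (Imp \<phi>1 \<phi>2)
  then obtain \<psi>1 \<psi>2 where "wf_fm L_set \<psi>1" "wf_fm L_set \<psi>2"
    "\<forall>e. range e \<subseteq> Collect num \<longrightarrow> sat M e \<psi>1 = sat numbers e \<phi>1"
    "\<forall>e. range e \<subseteq> Collect num \<longrightarrow> sat M e \<psi>2 = sat numbers e \<phi>2"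
    by auto
  then show ?case by (intro exI[of _ "Imp \<psi>1 \<psi>2"]) simp
next
  case (All \<phi>)
  then obtain \<psi> where "wf_fm L_set \<psi>" "\<forall>e. range e \<subseteq> Collect num \<longrightarrow> sat M e \<psi> = sat numbers e \<phi>"
    by auto
  then show ?case
    by (intro exI[of _ "All (Imp (num_fm 0) \<psi>)"]) (auto simp: range_case_nat wf_arith_fm num_in)
next
  case (Ex \<phi>)
  then obtain \<psi> where "wf_fm L_set \<psi>" "\<forall>e. range e \<subseteq> Collect num \<longrightarrow> sat M e \<psi> = sat numbers e \<phi>"
    by auto
  then show ?case
    by (intro exI[of _ "Ex (And (num_fm 0) \<psi>)"]) (auto simp: range_case_nat wf_arith_fm num_in)
qed

section \<open>The axioms of PA\<close>

lemma sat_induction_ax: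
  assumes \<phi>: "wf_fm L_PA \<phi>" and e: "range e \<subseteq> Collect num"
  shows "sat numbers e (induction_ax \<phi>)"
proof -
  obtain \<psi> where \<psi>: "wf_fm L_set \<psi>"
    "\<And>e. range e \<subseteq> Collect num \<Longrightarrow> sat M e \<psi> = sat numbers e \<phi>"
    using translate_fm[OF \<phi>] by auto
  \<comment> \<open>Definability concerns the whole carrier, where \<phi> has no meaning; hence the
    predicate is given by the translation and compared with \<phi> on numbers only.\<close>
  define A where "A x = sat M (case_nat x e) \<psi>" for x
  have A: "A x \<longleftrightarrow> sat numbers (case_nat x e) \<phi>" if "num x" for x
    unfolding A_def by (rule \<psi>(2)) (use e that in \<open>simp add: range_case_nat\<close>)
  have eC: "range e \<subseteq> C" using e num_in by auto
  have "definable A" unfolding definable_def A_def using \<psi>(1) eC by blast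
  have s0: "(\<lambda>i. tval numbers e (case_nat ZeroT Var i)) = case_nat (fn numbers Zero []) e"
    by (auto simp: fun_eq_iff split: nat.split)
  have s1: "(\<lambda>i. tval numbers (case_nat x e) (case_nat (SuccT (Var 0)) (\<lambda>i. Var (Suc i)) i)) =
      case_nat (fn numbers Succ [x]) e" for x
    by (auto simp: fun_eq_iff split: nat.split)
  have "sat numbers (case_nat n e) \<phi>"
    if z: "sat numbers (case_nat (fn numbers Zero []) e) \<phi>"
      and s: "\<And>x. num x \<Longrightarrow> sat numbers (case_nat x e) \<phi> \<Longrightarrow>
        sat numbers (case_nat (fn numbers Succ [x]) e) \<phi>"
      and n: "num n" for n
  proof -
    have "A n"
      using n \<open>definable A\<close>
    proof (rule num_induct)
      show "A x" if "x \<in> C" "is_zero x" for x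
        using z A[OF num_fn_numbers(1)] fn_numbers_iff(1)[OF that(1)] that(2) by simp
      show "A y" if "num x" "A x" "y \<in> C" "is_suc x y" for x y
        using s[OF that(1)] A[OF that(1)] A[OF num_fn_numbers(2)[OF that(1)]]
          fn_numbers_iff(2)[OF that(3,1)] that(2,4) by simp
    qed
    then show ?thesis using A n by simp
  qed
  then show ?thesis by (simp add: induction_ax_def sat_subst s0 s1)
qed

lemma models_PA_numbers:
  assumes \<phi>: "\<phi> \<in> PA" and e: "range e \<subseteq> Collect num"
  shows "sat numbers e \<phi>"
proof -
  let ?z = "fn numbers Zero []" and ?s = "\<lambda>x. fn numbers Succ [x]"
    and ?p = "\<lambda>x y. fn numbers Plus [x, y]" and ?t = "\<lambda>x y. fn numbers Times [x, y]"
  note N = num_fn_numbers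
  have z: "?z \<in> C" "is_zero ?z" using fn_numbers_iff(1)[of ?z] num_in[OF N(1)] by auto
  have s: "?s x \<in> C" "is_suc x (?s x)" if "num x" for x
    using fn_numbers_iff(2)[of "?s x" x] num_in[OF N(2)] that by auto
  have "?s x \<noteq> ?z" if "num x" for x
    using suc_not_zero[OF num_in[OF that] s(2)[OF that]] z(2) by auto
  moreover have "x = y" if "num x" "num y" "?s x = ?s y" for x y
    using suc_inject[OF that(2) num_in[OF that(1)] s(2)[OF that(1)]] s(2)[OF that(2)] that(3) by simp
  moreover have "?p m ?z = m" if "num m" for m
    using fn_numbers_iff(3)[OF num_in[OF that] that N(1)] recd_zero[OF z num_in[OF that]]
    by (simp add: is_plus_def)
  \<comment> \<open>The recursion equation shows that the formula for the sum holds of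
    \<open>?k\<close>, and the sum is the only element of which it holds. The product is treated in
    the same way.\<close>
  moreover have "?p m (?s n) = ?s (?p m n)" if m: "num m" and n: "num n" for m n
  proof -
    let ?k = "?s (?p m n)"
    have p: "num (?p m n)" and k: "?k \<in> C" using N(3)[OF m n] s(1) by auto
    have "is_plus m n (?p m n)" using fn_numbers_iff(3)[OF num_in[OF p] m n] by simp
    then have "is_plus m (?s n) ?k"
      using recd_suc[OF n s[OF n] k] s(2)[OF p] num_in[OF p] unfolding is_plus_def by blast
    then show ?thesis using fn_numbers_iff(3)[OF k m N(2)[OF n]] by simp
  qed
  moreover have "?t m ?z = ?z" if "num m" for m
    using fn_numbers_iff(4)[OF z(1) that N(1)] recd_zero[OF z z(1)] z(2)
    by (simp add: is_times_def)
  moreover have "?t m (?s n) = ?p (?t m n) m" if m: "num m" and n: "num n" for m n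
  proof -
    let ?k = "?p (?t m n) m"
    have t: "num (?t m n)" by (rule N(4)[OF m n])
    have k: "?k \<in> C" by (rule num_in[OF N(3)[OF t m]])
    have "is_times m n (?t m n)" using fn_numbers_iff(4)[OF num_in[OF t] m n] by simp
    moreover have "is_plus (?t m n) m ?k" using fn_numbers_iff(3)[OF k t m] by simp
    ultimately have "is_times m (?s n) ?k"
      using recd_suc[OF n s[OF n] k] num_in[OF t] unfolding is_times_def by blast
    then show ?thesis using fn_numbers_iff(4)[OF k m N(2)[OF n]] by simp
  qed
  ultimately show ?thesis
    using \<phi> sat_induction_ax[OF _ e] unfolding PA_def by auto
qed

lemma models_PA_quot: "models L_PA (quot_struct arith_interp M) PA"
  unfolding models_def
proof (intro conjI ballI allI impI)
  show "is_struct L_PA (quot_struct arith_interp M)"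
    by (rule quot_is_struct[OF defines_struct_arith])
  fix \<phi> and e :: "nat \<Rightarrow> 'm set" assume \<phi>: "\<phi> \<in> PA" and e: "range e \<subseteq> carrier (quot_struct arith_interp M)"
  have "carrier (quot_struct arith_interp M) = (\<lambda>x. {x}) ` Collect num"
    by (auto simp: quot_struct_def int_dom_arith int_eq_arith quotient_def)
  \<comment> \<open>Every class is a singleton, so the assignment comes from one into the
    numbers.\<close>
  then have "\<forall>i. \<exists>x. num x \<and> e i = {x}" using e by (auto simp: image_subset_iff image_iff)
  then obtain d where "\<And>i. num (d i)" "\<And>i. e i = {d i}" by metis
  then have d: "range d \<subseteq> Collect num" "e = (\<lambda>x. {x}) \<circ> d" by auto
  have "wf_fm L_PA \<phi>" using wf_PA \<phi> by blast
  from quot_numbers[OF this d(1)] models_PA_numbers[OF \<phi> d(1)]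
  show "sat (quot_struct arith_interp M) e \<phi>" unfolding d(2) by simp
qed

end

section \<open>The least number principle from Foundation and from Replacement\<close>

lemma set_modelI:
  assumes M: "models L_set M T" and T: "ReS0 \<subseteq> T"
  shows "set_model M"
proof -
  obtain c where c: "c \<in> carrier M" using M by (auto simp: models_def is_struct_def)
  \<comment> \<open>The five axioms extracted below are sentences, so a constant assignment
    suffices.\<close>
  have "sat M (\<lambda>_. c) \<phi>" if "\<phi> \<in> ReS0" for \<phi>
    using M T that c by (auto simp: models_def)
  then have *: "sat M (\<lambda>_. c) extensionality_ax" "sat M (\<lambda>_. c) empty_set_ax"
      "sat M (\<lambda>_. c) pairing_ax" "sat M (\<lambda>_. c) set_difference_ax" "sat M (\<lambda>_. c) union_ax"
    unfolding ReS0_def by blast+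
  show ?thesis
  proof
    show "x = y" if "x \<in> carrier M" "y \<in> carrier M"
      "\<And>z. z \<in> carrier M \<Longrightarrow> rl M Elem [z, x] \<longleftrightarrow> rl M Elem [z, y]" for x y
      using *(1) that by (simp add: extensionality_ax_def)
    show "\<exists>x\<in>carrier M. \<forall>z\<in>carrier M. \<not> rl M Elem [z, x]"
      using *(2) by (simp add: empty_set_ax_def)
    show "\<exists>p\<in>carrier M. \<forall>z\<in>carrier M. rl M Elem [z, p] \<longleftrightarrow> z = x \<or> z = y"
      if "x \<in> carrier M" "y \<in> carrier M" for x y
      using *(3) that by (simp add: pairing_ax_def eval_nat_numeral iff_conv_conj_imp)
    show "\<exists>p\<in>carrier M. \<forall>z\<in>carrier M. rl M Elem [z, p] \<longleftrightarrow> rl M Elem [z, x] \<and> \<not> rl M Elem [z, y]"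
      if "x \<in> carrier M" "y \<in> carrier M" for x y
      using *(4) that by (simp add: set_difference_ax_def eval_nat_numeral iff_conv_conj_imp)
    show "\<exists>p\<in>carrier M. \<forall>z\<in>carrier M. rl M Elem [z, p] \<longleftrightarrow>
        (\<exists>y\<in>carrier M. rl M Elem [y, x] \<and> rl M Elem [z, y])" if "x \<in> carrier M" for x
      using *(5) that by (simp add: union_ax_def eval_nat_numeral iff_conv_conj_imp)
  qed
qed

lemma set_induct_model_Foundation:
  assumes M: "models L_set M (ReS0 \<union> Foundation)"
  shows "set_induct_model M"
proof -
  interpret set_model M by (rule set_modelI[OF M]) simp
  show ?thesis
  proof
    fix A n assume A: "definable A" and n: "num n" "A n"
    obtain \<phi> e where \<phi>: "wf_fm L_set \<phi>" "range e \<subseteq> C" "\<forall>x\<in>C. A x \<longleftrightarrow> sat M (case_nat x e) \<phi>"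
      using A unfolding definable_def by blast
    \<comment> \<open>Foundation is applied to the numbers satisfying A. A minimal element of this
      class is a number with A, and no number below it has A.\<close>
    have "foundation_ax (And (num_fm 0) \<phi>) \<in> Foundation"
      using \<phi>(1) wf_arith_fm(3)[of 0] unfolding Foundation_def by auto
    then have *: "sat M e (foundation_ax (And (num_fm 0) \<phi>))" using M \<phi>(2) by (auto simp: models_def)
    have "sat M (case_nat x e) (And (num_fm 0) \<phi>) \<longleftrightarrow> num x \<and> A x" if "x \<in> C" for x
      using \<phi>(3) that by simp
    with * n num_in show "\<exists>m. num m \<and> A m \<and> (\<forall>k. num k \<and> k \<epsilon> m \<longrightarrow> \<not> A k)"
      unfolding sat_foundation_ax by (metis (no_types, lifting))
  qed
qed

text \<open>Replacement separates the elements of \<open>n \<union> {n}\<close> that satisfy \<open>A\<close>: the others are sent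
  to \<open>n\<close>, which satisfies \<open>A\<close>. A minimal element of the image is a least number with \<open>A\<close>.\<close>

lemma set_induct_model_Repl:
  assumes M: "models L_set M (ReS0 \<union> Repl)"
  shows "set_induct_model M"
proof -
  interpret set_model M by (rule set_modelI[OF M]) simp
  show ?thesis
  proof
    fix A n assume A: "definable A" and n: "num n" "A n"
    obtain \<phi> e where \<phi>: "wf_fm L_set \<phi>" "range e \<subseteq> C" "\<forall>x\<in>C. A x \<longleftrightarrow> sat M (case_nat x e) \<phi>"
      using A unfolding definable_def by blast
    have nC: "n \<in> C" by (rule num_in[OF n(1)])
    \<comment> \<open>Replacement acts on a = n \<union> {n}, so that n itself belongs to the
      image.\<close>
    obtain a where a: "a \<in> C" "is_suc n a" using ex_suc[OF nC] .
    \<comment> \<open>In the replacement formula, variables 0 to 3 are the value y, the argument x,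
      the set a and the default value n; the parameters of \<phi> start at 4. Thus variable 0 of
      \<phi> becomes 1 and the others move up by three.\<close>
    define \<alpha> where "\<alpha> = And (num_fm 1) (ren (case_nat 1 (\<lambda>i. i + 4)) \<phi>)"
    define \<psi> where "\<psi> = Or (And \<alpha> (EqV 0 1)) (And (Neg \<alpha>) (EqV 0 3))"
    let ?e = "case_nat a (case_nat n e)"
    have "wf_fm L_set \<psi>"
      using \<phi>(1) wf_arith_fm(3) by (auto simp: \<psi>_def \<alpha>_def intro!: wf_subst)
    then have "replacement_ax \<psi> \<in> Repl" unfolding Repl_def by blast
    moreover have "range ?e \<subseteq> C" using a(1) nC \<phi>(2) by (simp add: range_case_nat)
    ultimately have repl: "sat M ?e (replacement_ax \<psi>)" using M by (simp add: models_def)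
    have env: "(\<lambda>i. tval M (case_nat y (case_nat x ?e)) (Var (case_nat 1 (\<lambda>i. i + 4) i))) = case_nat x e"
      for x y by (auto simp: fun_eq_iff eval_nat_numeral split: nat.split)
    have \<alpha>: "sat M (case_nat y (case_nat x ?e)) \<alpha> \<longleftrightarrow> num x \<and> A x" if "x \<in> C" for x y
    proof -
      have "sat M (case_nat y (case_nat x ?e)) (ren (case_nat 1 (\<lambda>i. i + 4)) \<phi>) \<longleftrightarrow> A x"
        unfolding sat_subst env using \<phi>(3) that by simp
      moreover have "sat M (case_nat y (case_nat x ?e)) (num_fm 1) \<longleftrightarrow> num x" using that by simp
      ultimately show ?thesis unfolding \<alpha>_def by (simp only: sat.simps)
    qed
    have \<psi>: "sat M (case_nat y (case_nat x ?e)) \<psi> \<longleftrightarrow> y = (if num x \<and> A x then x else n)"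
      if "x \<in> C" for x y
      unfolding \<psi>_def sat.simps \<alpha>[OF that] by (auto simp: eval_nat_numeral)
    have "\<exists>b\<in>C. \<forall>y\<in>C. y \<epsilon> b \<longleftrightarrow> (\<exists>x\<in>C. x \<epsilon> ?e 0 \<and> sat M (case_nat y (case_nat x ?e)) \<psi>)"
      by (rule repl[unfolded sat_replacement_ax, rule_format]) (use nC in \<open>auto simp: \<psi>\<close>)
    then obtain b where b: "b \<in> C"
      "\<And>y. y \<in> C \<Longrightarrow> y \<epsilon> b \<longleftrightarrow> (\<exists>x\<in>C. x \<epsilon> a \<and> y = (if num x \<and> A x then x else n))"
      using \<psi> by auto
    have na: "x \<epsilon> a \<longleftrightarrow> x \<epsilon> n \<or> x = n" if "x \<in> C" for x by (rule suc_mem[OF a(2) that])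
    have bA: "num y \<and> A y" if "y \<in> C" "y \<epsilon> b" for y using b(2)[OF that(1)] that(2) n by auto
    have Ab: "y \<epsilon> b" if "num y" "A y" "y \<epsilon> a" for y using b(2)[OF num_in] num_in that by auto
    have "n \<epsilon> b" using Ab[OF n] na[OF nC] by simp
    moreover have "n \<epsilon> n \<or> n = n" by simp
    ultimately obtain w where w: "w \<in> C" "w \<epsilon> n \<or> w = n" "w \<epsilon> b" "\<forall>y\<in>C. y \<epsilon> w \<longrightarrow> \<not> y \<epsilon> b"
      using num_minimal[OF n(1) b(1) nC] by metis
    \<comment> \<open>Minimality within b suffices: a number k in w lies in n by transitivity, hence
      in a, and would belong to b if it had A.\<close>
    have "\<not> A k" if k: "num k" "k \<epsilon> w" for k
    proof -
      have "k \<epsilon> n" using w(2) k(2) num_trans[OF n(1) w(1) num_in[OF k(1)] k(2)] by auto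
      then show ?thesis using Ab[OF k(1)] na w(4) k num_in[OF k(1)] by blast
    qed
    then show "\<exists>m. num m \<and> A m \<and> (\<forall>k. num k \<and> k \<epsilon> m \<longrightarrow> \<not> A k)"
      using bA[OF w(1,3)] by blast
  qed
qed

text \<open>The witness is \<open>arith_interp\<close>, independent of the model and of the theory,
  so the formulas are fixed in advance.\<close>

lemma interprets_PA:
  assumes "\<And>M :: (unit, set_rel, 'm) struct. models L_set M T \<Longrightarrow> set_induct_model M"
  shows "interprets TYPE('m) L_set T L_PA PA"
  unfolding interprets_def is_interpretation_def
  using wf_arith_interp assms set_induct_model.defines_struct_arith set_induct_model.models_PA_quot
  by blast

theorem theorem4p5:
  shows "interprets TYPE('m) L_set (ReS0 \<union> Foundation) L_PA PA \<and>
         interprets TYPE('m) L_set (ReS0 \<union> Repl) L_PA PA"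
  using interprets_PA[OF set_induct_model_Foundation] interprets_PA[OF set_induct_model_Repl] by blast

end
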